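(* Let $F:(M_1^{m_1},g_1,J_1)\to(M_2^{m_2},g_2)$ be a pointwise slant Riemannian submersion with horizontal space of dimension $s\ge3$ and slant function $\theta$. Then, at every point: (1) If $M_1(c)$ is a real space form, then $$\rho_{\mathcal H}^{\mathcal H}\le\delta_C^{\mathcal H}(s-1)+c,\qquad\rho_{\mathcal H}^{\mathcal H}\le\hat\delta_C^{\mathcal H}(s-1)+c.$$ (2) If $M_1(c)$ is a complex space form, then $$\rho_{\mathcal H}^{\mathcal H}\le\delta_C^{\mathcal H}(s-1)+\frac c4\Big(1+\frac3{s-1}\cos^2\theta\Big),$$ and the same inequality holds with $\delta_C^{\mathcal H}(s-1)$ replaced by $\hat\delta_C^{\mathcal H}(s-1)$. (3) If $M_1(c)$ is a real Kähler space form (with parameters $c,\alpha$), then $$\rho_{\mathcal H}^{\mathcal H}\le\delta_C^{\mathcal H}(s-1)+\frac{c+3\alpha}4+\frac{3(c-\alpha)}{4(s-1)}\cos^2\theta,$$ and the same inequality holds with $\delta_C^{\mathcal H}(s-1)$ replaced by $\hat\delta_C^{\mathcal H}(s-1)$.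
   Context: All manifolds are smooth, connected, without boundary. A Riemannian submersion $F:(M_1^{m_1},g_1)\to(M_2^{m_2},g_2)$ has vertical distribution $\mathcal V=\ker F_*$ (of dimension $r$) and horizontal distribution $\mathcal H=(\ker F_* )^\perp$; $\mathcal V,\mathcal H$ also denote the orthogonal projections. $\nabla$ is the Levi-Civita connection of $g_1$. O'Neill's tensor $A$ is $A_EG=\mathcal V\nabla_{\mathcal HE}\mathcal HG+\mathcal H\nabla_{\mathcal HE}\mathcal VG$; for horizontal $X,Y$, $A_XY=\frac12\mathcal V[X,Y]$. Generalized complex space form $M_1(c_1,c_2)$: an almost Hermitian manifold $(M_1,g_1,J_1)$ ($J_1^2=-I$, $g_1(J_1X,J_1Y)=g_1(X,Y)$) whose curvature tensor $R^{M_1}$ satisfies, for smooth functions $c_1,c_2$, $$R^{M_1}(X,Y)Z=c_1\{g_1(Y,Z)X-g_1(X,Z)Y\}+c_2\{g_1(X,J_1Z)J_1Y-g_1(Y,J_1Z)J_1X+2g_1(X,J_1Y)J_1Z\}.$$ Special cases: real space form (constant sectional curvature $c$): $c_1=c$, $c_2=0$; complex space form (Kähler, constant holomorphic sectional curvature $c$): $c_1=c_2=c/4$; real Kähler space form: $c_1=(c+3\alpha)/4$, $c_2=(c-\alpha)/4$, with $c,\alpha$ real constants. Pointwise slant: for vertical $U$ and horizontal $X$ write $J_1U=P^{\mathcal V}U+Q^{\mathcal V}U$ and $J_1X=P^{\mathcal H}X+Q^{\mathcal H}X$ with $P^{\mathcal V}U$, $Q^{\mathcal H}X$ vertical and $Q^{\mathcal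 V}U$, $P^{\mathcal H}X$ horizontal. $F$ is pointwise slant with slant function $\theta:M_1\to[0,\pi/2]$ if at each $p$ the angle between $J_1U$ and $\mathcal V_p$ equals $\theta(p)$ for every nonzero $U\in\mathcal V_p$, i.e. $(P^{\mathcal V})^2=-\cos^2\theta\,I$. The convention used for the horizontal results is that the analogous identities hold for $P^{\mathcal H}$ with the same $\theta$: $(P^{\mathcal H})^2=-\cos^2\theta\,I$ on $\mathcal H$, hence $\|P^{\mathcal H}\|^2=\sum_{i,j=1}^s g_1(X_i,P^{\mathcal H}X_j)^2=s\cos^2\theta$. Curvature $R^{\mathcal H}$ of the horizontal distribution: it is related to $R^{M_1}$, for horizontal $X,Y,Z,W$, by $$g_1(R^{M_1}(X,Y)Z,W)=g_1(R^{\mathcal H}(X,Y)Z,W)-2g_1(A_XY,A_ZW)+g_1(A_YZ,A_XW)-g_1(A_XZ,A_YW),$$ and this relation is taken as the definition of $R^{\mathcal H}$. For an orthonormal basis $\{X_1,\dots,X_s\}$ of $\mathcal H_p$, $\rho_{\mathcal H}^{\mathcal H}=\frac{1}{s(s-1)}\sum_{i,j=1}^s g_1(R^{\mathcal H}(X_i,X_j)X_j,X_i)$. Horizontal Casorati curvatures at $p$: with $\{U_1,\dots,U_r\}$ an orthonormal basis of $\mathcal V_p$, put $A_{ij}^k=g_1(A_{X_i}X_j,U_k)$ and $C^{\mathcal H}=\frac1s\sum_{k=1}^r\sum_{i,j=1}^s(A_{ij}^k)^2$. For a $q$-dimensional subspace $L\subset\mathcal H_p$ ($q\ge2$) with orthonormal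 basis $\{X_1,\dots,X_q\}$, $C(L)=\frac1q\sum_{k=1}^r\sum_{i,j=1}^q(A_{ij}^k)^2$. With $L$ ranging over hyperplanes ($(s-1)$-dimensional subspaces) of $\mathcal H_p$, $$\delta_C^{\mathcal H}(s-1)=\tfrac12C^{\mathcal H}+\tfrac{s+1}{2s}\inf_LC(L),\qquad\hat\delta_C^{\mathcal H}(s-1)=2C^{\mathcal H}-\tfrac{2s-1}{2s}\sup_LC(L).$$ *)

theory Defs
  imports "HOL-Analysis.Analysis"
begin

section \<open>Smooth manifolds\<close>

fun C_k_on :: "nat \<Rightarrow> 'e::real_normed_vector set \<Rightarrow> ('e \<Rightarrow> 'f::real_normed_vector) \<Rightarrow> bool" where
  "C_k_on 0 S f \<longleftrightarrow> continuous_on S f"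
| "C_k_on (Suc k) S f \<longleftrightarrow>
     (\<forall>x\<in>S. f differentiable (at x)) \<and>
     (\<forall>v. C_k_on k S (\<lambda>x. frechet_derivative f (at x) v))"

text \<open>Only used for open sets \<open>S\<close>.\<close>

definition smooth_on :: "'e::real_normed_vector set \<Rightarrow> ('e \<Rightarrow> 'f::real_normed_vector) \<Rightarrow> bool" where
  "smooth_on S f \<longleftrightarrow> (\<forall>k. C_k_on k S f)"

text \<open>
  The underlying set of a manifold is a whole type \<open>'a\<close>, and its model space is \<open>'e\<close>, so its
  dimension is \<open>DIM('e)\<close>. The atlas is indexed by points: \<open>chart M p\<close> is a chart with domain
  \<open>chart_dom M p\<close> around \<open>p\<close>. Every smooth structure is generated by such a family.
  The tangent space at \<open>p\<close> is \<open>'e\<close>: a vector at \<open>p\<close> is given by its components in the chart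
  \<open>chart M p\<close> (and not in another chart around \<open>p\<close>).
\<close>

record ('a, 'e) manifold =
  chart_dom :: "'a \<Rightarrow> 'a set"
  chart :: "'a \<Rightarrow> 'a \<Rightarrow> 'e"

definition chart_inv :: "('a, 'e, 'm) manifold_scheme \<Rightarrow> 'a \<Rightarrow> 'e \<Rightarrow> 'a" where
  "chart_inv M p = inv_into (chart_dom M p) (chart M p)"

definition smooth_manifold ::
  "('a::{t2_space,second_countable_topology}, 'e::euclidean_space, 'm) manifold_scheme \<Rightarrow> bool" where
  "smooth_manifold M \<longleftrightarrow>
     connected (UNIV :: 'a set) \<and>
     (\<forall>p. p \<in> chart_dom M p \<and> open (chart_dom M p) \<and> open (chart M p ` chart_dom M p) \<and>
          homeomorphism (chart_dom M p) (chart M p ` chart_dom M p) (chart M p) (chart_inv M p)) \<and>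
     (\<forall>p q. smooth_on (chart M p ` (chart_dom M p \<inter> chart_dom M q)) (chart M q \<circ> chart_inv M p))"

definition smooth_near ::
  "('a::topological_space, 'e::euclidean_space, 'm) manifold_scheme \<Rightarrow> 'a \<Rightarrow>
   ('a \<Rightarrow> 'f::real_normed_vector) \<Rightarrow> bool" where
  "smooth_near M p f \<longleftrightarrow>
     (\<exists>U. open U \<and> p \<in> U \<and> U \<subseteq> chart_dom M p \<and> smooth_on (chart M p ` U) (f \<circ> chart_inv M p))"

definition smooth_map ::
  "('a::topological_space, 'e::euclidean_space, 'm) manifold_scheme \<Rightarrow>
   ('b::topological_space, 'f::euclidean_space, 'n) manifold_scheme \<Rightarrow> ('a \<Rightarrow> 'b) \<Rightarrow> bool" where
  "smooth_map M N F \<longleftrightarrow>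
     (\<forall>p. \<exists>U. open U \<and> p \<in> U \<and> U \<subseteq> chart_dom M p \<and> F ` U \<subseteq> chart_dom N (F p) \<and>
          smooth_on (chart M p ` U) (chart N (F p) \<circ> F \<circ> chart_inv M p))"

text \<open>Differential at \<open>p\<close> of a function with values in a vector space, and of a map of manifolds.\<close>

definition fun_diff ::
  "('a, 'e::real_normed_vector, 'm) manifold_scheme \<Rightarrow> ('a \<Rightarrow> 'f::real_normed_vector) \<Rightarrow> 'a \<Rightarrow> 'e \<Rightarrow> 'f" where
  "fun_diff M f p = frechet_derivative (f \<circ> chart_inv M p) (at (chart M p p))"

definition map_diff ::
  "('a, 'e::real_normed_vector, 'm) manifold_scheme \<Rightarrow> ('b, 'f::real_normed_vector, 'n) manifold_scheme \<Rightarrow>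
   ('a \<Rightarrow> 'b) \<Rightarrow> 'a \<Rightarrow> 'e \<Rightarrow> 'f" where
  "map_diff M N F p = fun_diff M (chart N (F p) \<circ> F) p"

section \<open>Vector fields\<close>

text \<open>
  A vector field is a function \<open>X :: 'a \<Rightarrow> 'e\<close> with \<open>X q\<close> in the tangent space at \<open>q\<close>.
  \<open>components M p X q\<close> are the components of \<open>X q\<close> in the chart chosen at \<open>p\<close>.
  Throughout, vector fields need only be smooth near the point under consideration.
\<close>

definition components ::
  "('a, 'e::real_normed_vector, 'm) manifold_scheme \<Rightarrow> 'a \<Rightarrow> ('a \<Rightarrow> 'e) \<Rightarrow> 'a \<Rightarrow> 'e" where
  "components M p X q = fun_diff M (chart M p) q (X q)"

definition smooth_field_near ::
  "('a::topological_space, 'e::euclidean_space, 'm) manifold_scheme \<Rightarrow> 'a \<Rightarrow> ('a \<Rightarrow> 'e) \<Rightarrow> bool" where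
  "smooth_field_near M p X \<longleftrightarrow> smooth_near M p (components M p X)"

definition lie_bracket ::
  "('a, 'e::real_normed_vector, 'm) manifold_scheme \<Rightarrow> ('a \<Rightarrow> 'e) \<Rightarrow> ('a \<Rightarrow> 'e) \<Rightarrow> 'a \<Rightarrow> 'e" where
  "lie_bracket M X Y p =
     fun_diff M (components M p Y) p (X p) - fun_diff M (components M p X) p (Y p)"

text \<open>
  The local extension of a vector \<open>v\<close> at \<open>p\<close> with constant components in the chart at \<open>p\<close>. It is
  used to evaluate tensors, which are defined on fields, on single tangent vectors; by tensoriality
  any other smooth extension gives the same value.
\<close>

definition extend_vec :: "('a, 'e::real_normed_vector, 'm) manifold_scheme \<Rightarrow> 'a \<Rightarrow> 'e \<Rightarrow> 'a \<Rightarrow> 'e" where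
  "extend_vec M p v q =
     (if q \<in> chart_dom M p
      then frechet_derivative (chart M q \<circ> chart_inv M p) (at (chart M p q)) v else 0)"

section \<open>Riemannian and almost Hermitian manifolds\<close>

record ('a, 'e) riemannian = "('a, 'e) manifold" +
  metric :: "'a \<Rightarrow> 'e \<Rightarrow> 'e \<Rightarrow> real"

definition riemannian_manifold ::
  "('a::{t2_space,second_countable_topology}, 'e::euclidean_space, 'm) riemannian_scheme \<Rightarrow> bool" where
  "riemannian_manifold M \<longleftrightarrow>
     smooth_manifold M \<and>
     (\<forall>p. bilinear (metric M p) \<and> (\<forall>x y. metric M p x y = metric M p y x) \<and>
          (\<forall>x. x \<noteq> 0 \<longrightarrow> metric M p x x > 0)) \<and>
     (\<forall>p X Y. smooth_field_near M p X \<longrightarrow> smooth_field_near M p Y \<longrightarrow>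
          smooth_near M p (\<lambda>q. metric M q (X q) (Y q)))"

definition metric_norm :: "('a, 'e, 'm) riemannian_scheme \<Rightarrow> 'a \<Rightarrow> 'e \<Rightarrow> real" where
  "metric_norm M p x = sqrt (metric M p x x)"

text \<open>A connection acts on local vector fields: \<open>nabla X Y\<close> is \<open>\<nabla>\<^sub>X Y\<close>.\<close>

definition levi_civita ::
  "('a::topological_space, 'e::euclidean_space, 'm) riemannian_scheme \<Rightarrow>
   (('a \<Rightarrow> 'e) \<Rightarrow> ('a \<Rightarrow> 'e) \<Rightarrow> 'a \<Rightarrow> 'e) \<Rightarrow> bool" where
  "levi_civita M nabla \<longleftrightarrow>
     (\<forall>p X Y Z f. smooth_field_near M p X \<longrightarrow> smooth_field_near M p Y \<longrightarrow>
        smooth_field_near M p Z \<longrightarrow> smooth_near M p f \<longrightarrow>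
          smooth_field_near M p (nabla X Y) \<and>
          nabla (\<lambda>q. X q + Y q) Z p = nabla X Z p + nabla Y Z p \<and>
          nabla (\<lambda>q. f q *\<^sub>R X q) Z p = f p *\<^sub>R nabla X Z p \<and>
          nabla X (\<lambda>q. Y q + Z q) p = nabla X Y p + nabla X Z p \<and>
          nabla X (\<lambda>q. f q *\<^sub>R Y q) p = f p *\<^sub>R nabla X Y p + fun_diff M f p (X p) *\<^sub>R Y p \<and>
          fun_diff M (\<lambda>q. metric M q (Y q) (Z q)) p (X p) =
            metric M p (nabla X Y p) (Z p) + metric M p (Y p) (nabla X Z p) \<and>
          nabla X Y p - nabla Y X p = lie_bracket M X Y p)"

definition curvature ::
  "('a, 'e::real_normed_vector, 'm) manifold_scheme \<Rightarrow> (('a \<Rightarrow> 'e) \<Rightarrow> ('a \<Rightarrow> 'e) \<Rightarrow> 'a \<Rightarrow> 'e) \<Rightarrow>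
   ('a \<Rightarrow> 'e) \<Rightarrow> ('a \<Rightarrow> 'e) \<Rightarrow> ('a \<Rightarrow> 'e) \<Rightarrow> 'a \<Rightarrow> 'e" where
  "curvature M nabla X Y Z p =
     nabla X (nabla Y Z) p - nabla Y (nabla X Z) p - nabla (lie_bracket M X Y) Z p"

definition curvature_at ::
  "('a, 'e::real_normed_vector, 'm) manifold_scheme \<Rightarrow> (('a \<Rightarrow> 'e) \<Rightarrow> ('a \<Rightarrow> 'e) \<Rightarrow> 'a \<Rightarrow> 'e) \<Rightarrow>
   'a \<Rightarrow> 'e \<Rightarrow> 'e \<Rightarrow> 'e \<Rightarrow> 'e" where
  "curvature_at M nabla p x y z = curvature M nabla (extend_vec M p x) (extend_vec M p y) (extend_vec M p z) p"

record ('a, 'e) hermitian = "('a, 'e) riemannian" +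
  cplx :: "'a \<Rightarrow> 'e \<Rightarrow> 'e"

definition almost_hermitian ::
  "('a::{t2_space,second_countable_topology}, 'e::euclidean_space, 'm) hermitian_scheme \<Rightarrow> bool" where
  "almost_hermitian M \<longleftrightarrow>
     riemannian_manifold M \<and>
     (\<forall>p. linear (cplx M p) \<and> (\<forall>x. cplx M p (cplx M p x) = - x) \<and>
          (\<forall>x y. metric M p (cplx M p x) (cplx M p y) = metric M p x y)) \<and>
     (\<forall>p X. smooth_field_near M p X \<longrightarrow> smooth_field_near M p (\<lambda>q. cplx M q (X q)))"

definition kaehler ::
  "('a::{t2_space,second_countable_topology}, 'e::euclidean_space, 'm) hermitian_scheme \<Rightarrow>
   (('a \<Rightarrow> 'e) \<Rightarrow> ('a \<Rightarrow> 'e) \<Rightarrow> 'a \<Rightarrow> 'e) \<Rightarrow> bool" where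
  "kaehler M nabla \<longleftrightarrow>
     almost_hermitian M \<and>
     (\<forall>p X Y. smooth_field_near M p X \<longrightarrow> smooth_field_near M p Y \<longrightarrow>
        nabla X (\<lambda>q. cplx M q (Y q)) p = cplx M p (nabla X Y p))"

definition generalized_complex_space_form ::
  "('a::{t2_space,second_countable_topology}, 'e::euclidean_space, 'm) hermitian_scheme \<Rightarrow>
   (('a \<Rightarrow> 'e) \<Rightarrow> ('a \<Rightarrow> 'e) \<Rightarrow> 'a \<Rightarrow> 'e) \<Rightarrow> ('a \<Rightarrow> real) \<Rightarrow> ('a \<Rightarrow> real) \<Rightarrow> bool" where
  "generalized_complex_space_form M nabla c1 c2 \<longleftrightarrow>
     almost_hermitian M \<and> (\<forall>p. smooth_near M p c1 \<and> smooth_near M p c2) \<and>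
     (\<forall>p X Y Z. smooth_field_near M p X \<longrightarrow> smooth_field_near M p Y \<longrightarrow> smooth_field_near M p Z \<longrightarrow>
        (let g = metric M p; J = cplx M p; x = X p; y = Y p; z = Z p in
         curvature M nabla X Y Z p =
           c1 p *\<^sub>R (g y z *\<^sub>R x - g x z *\<^sub>R y) +
           c2 p *\<^sub>R (g x (J z) *\<^sub>R J y - g y (J z) *\<^sub>R J x + (2 * g x (J y)) *\<^sub>R J z)))"

text \<open>The curvature identity makes the (holomorphic) sectional curvature equal to \<open>c\<close>.\<close>

definition real_space_form ::
  "('a::{t2_space,second_countable_topology}, 'e::euclidean_space, 'm) hermitian_scheme \<Rightarrow>
   (('a \<Rightarrow> 'e) \<Rightarrow> ('a \<Rightarrow> 'e) \<Rightarrow> 'a \<Rightarrow> 'e) \<Rightarrow> real \<Rightarrow> bool" where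
  "real_space_form M nabla c \<longleftrightarrow>
     generalized_complex_space_form M nabla (\<lambda>_. c) (\<lambda>_. 0)"

definition complex_space_form ::
  "('a::{t2_space,second_countable_topology}, 'e::euclidean_space, 'm) hermitian_scheme \<Rightarrow>
   (('a \<Rightarrow> 'e) \<Rightarrow> ('a \<Rightarrow> 'e) \<Rightarrow> 'a \<Rightarrow> 'e) \<Rightarrow> real \<Rightarrow> bool" where
  "complex_space_form M nabla c \<longleftrightarrow>
     kaehler M nabla \<and> generalized_complex_space_form M nabla (\<lambda>_. c / 4) (\<lambda>_. c / 4)"

text \<open>A real Kaehler (RK-) space form need not be Kaehler.\<close>

definition real_kaehler_space_form ::
  "('a::{t2_space,second_countable_topology}, 'e::euclidean_space, 'm) hermitian_scheme \<Rightarrow>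
   (('a \<Rightarrow> 'e) \<Rightarrow> ('a \<Rightarrow> 'e) \<Rightarrow> 'a \<Rightarrow> 'e) \<Rightarrow> real \<Rightarrow> real \<Rightarrow> bool" where
  "real_kaehler_space_form M nabla c \<alpha> \<longleftrightarrow>
     generalized_complex_space_form M nabla (\<lambda>_. (c + 3 * \<alpha>) / 4) (\<lambda>_. (c - \<alpha>) / 4)"

section \<open>Linear algebra with respect to the metric\<close>

definition orth_proj :: "('e \<Rightarrow> 'e \<Rightarrow> real) \<Rightarrow> 'e::real_vector set \<Rightarrow> 'e \<Rightarrow> 'e" where
  "orth_proj g W v = (THE u. u \<in> W \<and> (\<forall>w\<in>W. g (v - u) w = 0))"

definition is_orthonormal_basis ::
  "('e \<Rightarrow> 'e \<Rightarrow> real) \<Rightarrow> 'e::real_vector set \<Rightarrow> (nat \<Rightarrow> 'e) \<Rightarrow> bool" where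
  "is_orthonormal_basis g W X \<longleftrightarrow>
     X ` {1..dim W} \<subseteq> W \<and> span (X ` {1..dim W}) = W \<and>
     (\<forall>i\<in>{1..dim W}. \<forall>j\<in>{1..dim W}. g (X i) (X j) = (if i = j then 1 else 0))"

text \<open>The quantities computed below with this basis do not depend on its choice.\<close>

definition orthonormal_basis :: "('e \<Rightarrow> 'e \<Rightarrow> real) \<Rightarrow> 'e::real_vector set \<Rightarrow> nat \<Rightarrow> 'e" where
  "orthonormal_basis g W = (SOME X. is_orthonormal_basis g W X)"

section \<open>Riemannian submersions\<close>

definition vertical ::
  "('a, 'e::real_normed_vector, 'm) manifold_scheme \<Rightarrow> ('b, 'f::real_normed_vector, 'n) manifold_scheme \<Rightarrow>
   ('a \<Rightarrow> 'b) \<Rightarrow> 'a \<Rightarrow> 'e set" where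
  "vertical M N F p = {v. map_diff M N F p v = 0}"

definition horizontal ::
  "('a, 'e::real_normed_vector, 'm) riemannian_scheme \<Rightarrow> ('b, 'f::real_normed_vector, 'n) manifold_scheme \<Rightarrow>
   ('a \<Rightarrow> 'b) \<Rightarrow> 'a \<Rightarrow> 'e set" where
  "horizontal M N F p = {x. \<forall>v\<in>vertical M N F p. metric M p x v = 0}"

definition riemannian_submersion ::
  "('a::{t2_space,second_countable_topology}, 'e::euclidean_space, 'm) riemannian_scheme \<Rightarrow>
   ('b::{t2_space,second_countable_topology}, 'f::euclidean_space, 'n) riemannian_scheme \<Rightarrow>
   ('a \<Rightarrow> 'b) \<Rightarrow> bool" where
  "riemannian_submersion M N F \<longleftrightarrow>
     riemannian_manifold M \<and> riemannian_manifold N \<and> smooth_map M N F \<and>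
     (\<forall>p. surj (map_diff M N F p)) \<and>
     (\<forall>p. \<forall>x\<in>horizontal M N F p. \<forall>y\<in>horizontal M N F p.
        metric N (F p) (map_diff M N F p x) (map_diff M N F p y) = metric M p x y)"

definition vproj ::
  "('a, 'e::real_normed_vector, 'm) riemannian_scheme \<Rightarrow> ('b, 'f::real_normed_vector, 'n) manifold_scheme \<Rightarrow>
   ('a \<Rightarrow> 'b) \<Rightarrow> 'a \<Rightarrow> 'e \<Rightarrow> 'e" where
  "vproj M N F p = orth_proj (metric M p) (vertical M N F p)"

definition hproj ::
  "('a, 'e::real_normed_vector, 'm) riemannian_scheme \<Rightarrow> ('b, 'f::real_normed_vector, 'n) manifold_scheme \<Rightarrow>
   ('a \<Rightarrow> 'b) \<Rightarrow> 'a \<Rightarrow> 'e \<Rightarrow> 'e" where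
  "hproj M N F p = orth_proj (metric M p) (horizontal M N F p)"

text \<open>
  The first condition is that the angle between \<open>JU\<close> and the vertical space is \<open>\<theta>\<close>; the second one
  is \<open>P\<^sup>2 = - cos\<^sup>2 \<theta>\<close> on the horizontal space, where \<open>PX\<close> is the horizontal part of \<open>JX\<close>.
\<close>

definition pointwise_slant_submersion ::
  "('a::{t2_space,second_countable_topology}, 'e::euclidean_space, 'm) hermitian_scheme \<Rightarrow>
   ('b::{t2_space,second_countable_topology}, 'f::euclidean_space, 'n) riemannian_scheme \<Rightarrow>
   ('a \<Rightarrow> 'b) \<Rightarrow> ('a \<Rightarrow> real) \<Rightarrow> bool" where
  "pointwise_slant_submersion M N F \<theta> \<longleftrightarrow>
     almost_hermitian M \<and> riemannian_submersion M N F \<and>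
     (\<forall>p. \<theta> p \<in> {0..pi/2}) \<and>
     (\<forall>p. \<forall>u\<in>vertical M N F p. u \<noteq> 0 \<longrightarrow>
        arccos (metric_norm M p (vproj M N F p (cplx M p u)) / metric_norm M p (cplx M p u)) = \<theta> p) \<and>
     (\<forall>p. \<forall>x\<in>horizontal M N F p.
        hproj M N F p (cplx M p (hproj M N F p (cplx M p x))) = - ((cos (\<theta> p))\<^sup>2 *\<^sub>R x))"

section \<open>O'Neill's tensor, horizontal curvature and Casorati curvatures\<close>

definition oneill_A ::
  "('a, 'e::real_normed_vector, 'm) riemannian_scheme \<Rightarrow> ('b, 'f::real_normed_vector, 'n) manifold_scheme \<Rightarrow>
   ('a \<Rightarrow> 'b) \<Rightarrow> (('a \<Rightarrow> 'e) \<Rightarrow> ('a \<Rightarrow> 'e) \<Rightarrow> 'a \<Rightarrow> 'e) \<Rightarrow> ('a \<Rightarrow> 'e) \<Rightarrow> ('a \<Rightarrow> 'e) \<Rightarrow> 'a \<Rightarrow> 'e" where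
  "oneill_A M N F nabla E G p =
     vproj M N F p (nabla (\<lambda>q. hproj M N F q (E q)) (\<lambda>q. hproj M N F q (G q)) p) +
     hproj M N F p (nabla (\<lambda>q. hproj M N F q (E q)) (\<lambda>q. vproj M N F q (G q)) p)"

definition oneill_A_at ::
  "('a, 'e::real_normed_vector, 'm) riemannian_scheme \<Rightarrow> ('b, 'f::real_normed_vector, 'n) manifold_scheme \<Rightarrow>
   ('a \<Rightarrow> 'b) \<Rightarrow> (('a \<Rightarrow> 'e) \<Rightarrow> ('a \<Rightarrow> 'e) \<Rightarrow> 'a \<Rightarrow> 'e) \<Rightarrow> 'a \<Rightarrow> 'e \<Rightarrow> 'e \<Rightarrow> 'e" where
  "oneill_A_at M N F nabla p x y = oneill_A M N F nabla (extend_vec M p x) (extend_vec M p y) p"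

text \<open>\<open>horizontal_curvature M N F nabla p x y z\<close> is \<open>R(x,y)z\<close> for the curvature \<open>R\<close> of the
  horizontal distribution, and is meaningful for horizontal \<open>x\<close>, \<open>y\<close>, \<open>z\<close>.\<close>

definition horizontal_curvature ::
  "('a, 'e::real_normed_vector, 'm) riemannian_scheme \<Rightarrow> ('b, 'f::real_normed_vector, 'n) manifold_scheme \<Rightarrow>
   ('a \<Rightarrow> 'b) \<Rightarrow> (('a \<Rightarrow> 'e) \<Rightarrow> ('a \<Rightarrow> 'e) \<Rightarrow> 'a \<Rightarrow> 'e) \<Rightarrow> 'a \<Rightarrow> 'e \<Rightarrow> 'e \<Rightarrow> 'e \<Rightarrow> 'e" where
  "horizontal_curvature M N F nabla p x y z =
     (let g = metric M p; A = oneill_A_at M N F nabla p in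
      THE v. v \<in> horizontal M N F p \<and>
        (\<forall>w\<in>horizontal M N F p.
           g (curvature_at M nabla p x y z) w =
             g v w - 2 * g (A x y) (A z w) + g (A y z) (A x w) - g (A x z) (A y w)))"

definition rho_H ::
  "('a, 'e::real_normed_vector, 'm) riemannian_scheme \<Rightarrow> ('b, 'f::real_normed_vector, 'n) manifold_scheme \<Rightarrow>
   ('a \<Rightarrow> 'b) \<Rightarrow> (('a \<Rightarrow> 'e) \<Rightarrow> ('a \<Rightarrow> 'e) \<Rightarrow> 'a \<Rightarrow> 'e) \<Rightarrow> 'a \<Rightarrow> real" where
  "rho_H M N F nabla p =
     (let g = metric M p; s = dim (horizontal M N F p);
          X = orthonormal_basis g (horizontal M N F p) in
      1 / (real s * (real s - 1)) *
        (\<Sum>i=1..s. \<Sum>j=1..s. g (horizontal_curvature M N F nabla p (X i) (X j) (X j)) (X i)))"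

text \<open>\<open>casorati M N F nabla p L\<close> is \<open>C(L)\<close> for a subspace \<open>L\<close> of the horizontal space at \<open>p\<close>; for
  \<open>L\<close> the whole horizontal space it is the horizontal Casorati curvature.\<close>

definition casorati ::
  "('a, 'e::real_normed_vector, 'm) riemannian_scheme \<Rightarrow> ('b, 'f::real_normed_vector, 'n) manifold_scheme \<Rightarrow>
   ('a \<Rightarrow> 'b) \<Rightarrow> (('a \<Rightarrow> 'e) \<Rightarrow> ('a \<Rightarrow> 'e) \<Rightarrow> 'a \<Rightarrow> 'e) \<Rightarrow> 'a \<Rightarrow> 'e set \<Rightarrow> real" where
  "casorati M N F nabla p L =
     (let g = metric M p; A = oneill_A_at M N F nabla p;
          r = dim (vertical M N F p); U = orthonormal_basis g (vertical M N F p);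
          q = dim L; X = orthonormal_basis g L in
      1 / real q * (\<Sum>k=1..r. \<Sum>i=1..q. \<Sum>j=1..q. (g (A (X i) (X j)) (U k))\<^sup>2))"

definition hyperplanes :: "'e::real_vector set \<Rightarrow> 'e set set" where
  "hyperplanes H = {L. subspace L \<and> L \<subseteq> H \<and> dim L = dim H - 1}"

definition delta_C ::
  "('a, 'e::real_normed_vector, 'm) riemannian_scheme \<Rightarrow> ('b, 'f::real_normed_vector, 'n) manifold_scheme \<Rightarrow>
   ('a \<Rightarrow> 'b) \<Rightarrow> (('a \<Rightarrow> 'e) \<Rightarrow> ('a \<Rightarrow> 'e) \<Rightarrow> 'a \<Rightarrow> 'e) \<Rightarrow> 'a \<Rightarrow> real" where
  "delta_C M N F nabla p =
     (let H = horizontal M N F p; s = real (dim H) in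
      1 / 2 * casorati M N F nabla p H +
      (s + 1) / (2 * s) * (INF L\<in>hyperplanes H. casorati M N F nabla p L))"

definition delta_C_hat ::
  "('a, 'e::real_normed_vector, 'm) riemannian_scheme \<Rightarrow> ('b, 'f::real_normed_vector, 'n) manifold_scheme \<Rightarrow>
   ('a \<Rightarrow> 'b) \<Rightarrow> (('a \<Rightarrow> 'e) \<Rightarrow> ('a \<Rightarrow> 'e) \<Rightarrow> 'a \<Rightarrow> 'e) \<Rightarrow> 'a \<Rightarrow> real" where
  "delta_C_hat M N F nabla p =
     (let H = horizontal M N F p; s = real (dim H) in
      2 * casorati M N F nabla p H -
      (2 * s - 1) / (2 * s) * (SUP L\<in>hyperplanes H. casorati M N F nabla p L))"

end

theory Submission
  imports Defs
begin

text \<open>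
  Fix the point \<open>p\<close>, let \<open>X\<^sub>1, \<dots>, X\<^sub>s\<close> be an orthonormal basis of the horizontal space and \<open>A\<close> O'Neill's
  tensor. On horizontal vectors \<open>A\<close> is alternating, so the relation that defines the horizontal
  curvature gives \<open>g(R\<^sup>H(x,y)y, x) = g(R(x,y)y, x) - 3 g(A\<^sub>x y, A\<^sub>x y)\<close>. Dropping the squares, \<open>\<rho>\<close> is at most
  the normalised sum of the \<open>g(R(X\<^sub>i,X\<^sub>j)X\<^sub>j, X\<^sub>i)\<close> (\<open>rho_H_le\<close>). For a generalized complex space form and a
  pointwise slant submersion this bound is \<open>c\<^sub>1 + 3 c\<^sub>2 cos\<^sup>2 \<theta> / (s - 1)\<close>
  (\<open>space_form_curvature_sum\<close>), which is the asserted bound without its Casorati term. Both Casorati terms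
  are nonnegative. For \<open>\<delta>\<close> this is clear, as it is a positive combination of sums of squares and an
  infimum of such. For the hatted one, Bessel's inequality gives \<open>(s - 1) C(L) \<le> s C\<close> for every hyperplane
  \<open>L\<close> (\<open>casorati_hyperplane\<close>), where \<open>C\<close> belongs to the whole horizontal space, and
  \<open>2 - (2s - 1)/(2s) \<cdot> s/(s - 1)\<close> is still positive.

  The geometric content is thus that \<open>A\<close> is alternating (\<open>oneill_A_alternating\<close>). For horizontal
  fields \<open>X\<close>, \<open>Y\<close> and a vertical field \<open>U\<close>, the properties of the Levi-Civita connection give
  \<open>g(A\<^sub>X Y + A\<^sub>Y X, U) = g([U,X], Y) + g(X, [U,Y]) - U g(X,Y)\<close>, which is minus
  the Lie derivative of \<open>g\<close> along \<open>U\<close>, evaluated on \<open>X\<close> and \<open>Y\<close>.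
  On horizontal vectors \<open>g\<close> is the pullback of the metric of the base by \<open>F\<close>, and this pullback is
  invariant along the fibres. In a chart, with \<open>f\<close> the local expression of \<open>F\<close>, the invariance says
  that both \<open>F\<^sub>*[U,X]\<close> and the derivative of \<open>F\<^sub>*X\<close> along \<open>U\<close> equal \<open>D\<^sup>2f(u,x)\<close>
  (\<open>vertical_lie_derivative\<close>). The symmetry of second derivatives enters here.

  The connection is only controlled on smooth fields, so the horizontal projections of the fields with
  constant components, to which \<open>A\<close> is applied, must be shown to be smooth (\<open>smooth_hfield\<close>). The
  projection of \<open>E\<close> is the field which represents \<open>w \<mapsto> g\<^sub>2(F\<^sub>*E, F\<^sub>*w)\<close> with respect to the metric, and
  representing fields of smooth functionals are smooth (\<open>smooth_riesz\<close>).
\<close>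

section \<open>Calculus of smooth functions\<close>

lemma C_k_on_cong:
  assumes "open S" "\<And>x. x \<in> S \<Longrightarrow> f x = g x" "C_k_on k S f"
  shows "C_k_on k S g"
  using assms(2,3)
proof (induction k arbitrary: f g)
  case 0
  then show ?case using continuous_on_cong by force
next
  case (Suc k)
  have diff: "f differentiable (at x)" if "x \<in> S" for x
    using Suc.prems that by simp
  have der: "(g has_derivative frechet_derivative f (at x)) (at x)" if "x \<in> S" for x
    using diff[OF that] Suc.prems(1) assms(1) that
    by (metis frechet_derivative_works has_derivative_transform_within_open)
  then have eq: "frechet_derivative f (at x) = frechet_derivative g (at x)" if "x \<in> S" for x
    using frechet_derivative_at that by blast
  show ?case
    using Suc.IH[where f = "\<lambda>x. frechet_derivative f (at x) v" and
        g = "\<lambda>x. frechet_derivative g (at x) v" for v] Suc.prems(2) der eq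
    by (auto simp: differentiable_def)
qed

lemma C_k_on_subset: "C_k_on k S f \<Longrightarrow> T \<subseteq> S \<Longrightarrow> C_k_on k T f"
  by (induction k arbitrary: f) (auto intro: continuous_on_subset)

lemma C_k_on_Suc: "C_k_on (Suc k) S f \<Longrightarrow> C_k_on k S f"
proof (induction k arbitrary: f)
  case 0
  then show ?case
    by (auto intro!: continuous_at_imp_continuous_on differentiable_imp_continuous_within)
next
  case (Suc k)
  then show ?case by (subst C_k_on.simps) auto
qed

text \<open>
  Every closure property below is an induction on \<open>k\<close>: once the derivative is known in closed form,
  only its regularity of order \<open>k\<close> has to be checked.
\<close>

lemma C_k_on_SucI:
  assumes "open S" "\<And>x. x \<in> S \<Longrightarrow> (f has_derivative f' x) (at x)"
    and "\<And>v. C_k_on k S (\<lambda>x. f' x v)"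
  shows "C_k_on (Suc k) S f"
proof -
  have "f' x = frechet_derivative f (at x)" if "x \<in> S" for x
    using assms(2) frechet_derivative_at that by metis
  then have "C_k_on k S (\<lambda>x. frechet_derivative f (at x) v)" for v
    by (intro C_k_on_cong[OF assms(1) _ assms(3)]) auto
  then show ?thesis
    using assms(2) by (auto simp: differentiable_def)
qed

lemma C_k_on_SucD:
  assumes "C_k_on (Suc k) S f" "x \<in> S"
  shows "(f has_derivative frechet_derivative f (at x)) (at x)"
  using assms frechet_derivative_works by auto

lemma C_k_on_const: "C_k_on k S (\<lambda>x. c)"
  by (induction k arbitrary: c) auto

lemma C_k_on_add:
  assumes "open S" "C_k_on k S f" "C_k_on k S g"
  shows "C_k_on k S (\<lambda>x. f x + g x)"
  using assms(2,3)
proof (induction k arbitrary: f g)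
  case 0 then show ?case by (auto intro: continuous_intros)
next
  case (Suc k)
  show ?case
    by (rule C_k_on_SucI[OF assms(1) has_derivative_add[OF C_k_on_SucD[OF Suc.prems(1)] C_k_on_SucD[OF Suc.prems(2)]]])
      (use Suc in auto)
qed

lemma C_k_on_bilinear:
  assumes "open S" "bounded_bilinear b" "C_k_on k S f" "C_k_on k S g"
  shows "C_k_on k S (\<lambda>x. b (f x) (g x))"
  using assms(3,4)
proof (induction k arbitrary: f g)
  case 0 then show ?case
    using bounded_bilinear.continuous_on[OF assms(2)] by auto
next
  case (Suc k)
  show ?case
  proof (rule C_k_on_SucI[OF assms(1) bounded_bilinear.FDERIV[OF assms(2)
          C_k_on_SucD[OF Suc.prems(1)] C_k_on_SucD[OF Suc.prems(2)]]])
    show "C_k_on k S (\<lambda>x. b (f x) (frechet_derivative g (at x) v) +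
        b (frechet_derivative f (at x) v) (g x))" for v
      using Suc C_k_on_Suc[OF Suc.prems(1)] C_k_on_Suc[OF Suc.prems(2)]
      by (intro C_k_on_add[OF assms(1)] Suc.IH) auto
  qed
qed

lemma C_k_on_inverse:
  fixes f :: "'e::real_normed_vector \<Rightarrow> real"
  assumes "open S" "\<And>x. x \<in> S \<Longrightarrow> f x \<noteq> 0" "C_k_on k S f"
  shows "C_k_on k S (\<lambda>x. inverse (f x))"
  using assms(3)
proof (induction k)
  case 0 then show ?case using assms(2) by (auto intro!: continuous_intros)
next
  case (Suc k)
  have IH: "C_k_on k S (\<lambda>x. inverse (f x))"
    using Suc C_k_on_Suc by blast
  show ?case
  proof (rule C_k_on_SucI[OF assms(1) Deriv.has_derivative_inverse[OF assms(2) C_k_on_SucD[OF Suc.prems]]])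
    have "C_k_on k S (\<lambda>x. (-1) * (inverse (f x) * frechet_derivative f (at x) v * inverse (f x)))" for v
      using Suc.prems IH
      by (intro C_k_on_bilinear[OF assms(1) bounded_bilinear_mult] C_k_on_const) auto
    then show "C_k_on k S (\<lambda>x. - (inverse (f x) * frechet_derivative f (at x) v * inverse (f x)))" for v
      by simp
  qed
qed

lemma smooth_on_cong:
  assumes "open S" "\<And>x. x \<in> S \<Longrightarrow> f x = g x" "smooth_on S f"
  shows "smooth_on S g"
  using assms C_k_on_cong unfolding smooth_on_def by blast

lemma smooth_on_subset: "smooth_on S f \<Longrightarrow> T \<subseteq> S \<Longrightarrow> smooth_on T f"
  unfolding smooth_on_def using C_k_on_subset by blast

lemma smooth_on_const: "smooth_on S (\<lambda>x. c)"
  by (simp add: smooth_on_def C_k_on_const)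

lemma smooth_on_add:
  "open S \<Longrightarrow> smooth_on S f \<Longrightarrow> smooth_on S g \<Longrightarrow> smooth_on S (\<lambda>x. f x + g x)"
  by (simp add: smooth_on_def C_k_on_add)

lemma smooth_on_bilinear:
  "open S \<Longrightarrow> bounded_bilinear b \<Longrightarrow> smooth_on S f \<Longrightarrow> smooth_on S g \<Longrightarrow>
    smooth_on S (\<lambda>x. b (f x) (g x))"
  by (simp add: smooth_on_def C_k_on_bilinear)

lemmas smooth_on_mult = smooth_on_bilinear[OF _ bounded_bilinear_mult]
lemmas smooth_on_scaleR = smooth_on_bilinear[OF _ bounded_bilinear_scaleR]
lemmas smooth_on_inner = smooth_on_bilinear[OF _ bounded_bilinear_inner]

lemma smooth_on_inverse:
  fixes f :: "'e::real_normed_vector \<Rightarrow> real"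
  shows "open S \<Longrightarrow> (\<And>x. x \<in> S \<Longrightarrow> f x \<noteq> 0) \<Longrightarrow> smooth_on S f \<Longrightarrow>
    smooth_on S (\<lambda>x. inverse (f x))"
  by (simp add: smooth_on_def C_k_on_inverse)

lemma smooth_on_diff:
  assumes "open S" "smooth_on S f" "smooth_on S g"
  shows "smooth_on S (\<lambda>x. f x - g x)"
  using smooth_on_add[OF assms(1,2) smooth_on_scaleR[OF assms(1) smooth_on_const[where c="-1"] assms(3)]]
  by simp

lemma smooth_on_sum:
  assumes "open S" "\<And>i. i \<in> I \<Longrightarrow> smooth_on S (f i)"
  shows "smooth_on S (\<lambda>x. \<Sum>i\<in>I. f i x)"
  using assms(2)
  by (induction I rule: infinite_finite_induct) (auto intro: smooth_on_const smooth_on_add[OF assms(1)])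

lemma smooth_on_differentiable: "smooth_on S f \<Longrightarrow> x \<in> S \<Longrightarrow> f differentiable (at x)"
  unfolding smooth_on_def by (metis C_k_on.simps(2))

lemma smooth_on_continuous: "smooth_on S f \<Longrightarrow> continuous_on S f"
  unfolding smooth_on_def by (metis C_k_on.simps(1))

lemma smooth_on_derivative: "smooth_on S f \<Longrightarrow> smooth_on S (\<lambda>x. frechet_derivative f (at x) v)"
  unfolding smooth_on_def by (metis C_k_on.simps(2))

lemma linear_eq_sum_Basis:
  fixes x :: "'e::euclidean_space"
  assumes "linear h"
  shows "h x = (\<Sum>b\<in>Basis. (x \<bullet> b) *\<^sub>R h b)"
proof -
  have "h x = h (\<Sum>b\<in>Basis. (x \<bullet> b) *\<^sub>R b)" by (simp add: euclidean_representation)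
  then show ?thesis by (simp add: linear_sum[OF assms] linear_cmul[OF assms])
qed

text \<open>
  The chain rule writes the derivative of \<open>g \<circ> f\<close> in terms of \<open>f'\<close> and of the compositions with \<open>f\<close> of the
  derivatives of \<open>g\<close> along basis vectors; the induction hypothesis for other \<open>g\<close> covers the latter.
\<close>

lemma C_k_on_compose:
  fixes f :: "'e::real_normed_vector \<Rightarrow> 'f::euclidean_space" and g :: "'f \<Rightarrow> 'g::real_normed_vector"
  assumes "open S" "open T" "f ` S \<subseteq> T" "smooth_on S f" "smooth_on T g"
  shows "C_k_on k S (\<lambda>x. g (f x))"
  using assms(5)
proof (induction k arbitrary: g)
  case 0
  then show ?case
    using continuous_on_compose2[OF smooth_on_continuous smooth_on_continuous[OF assms(4)] assms(3)] by simp
next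
  case (Suc k)
  have df: "(f has_derivative frechet_derivative f (at x)) (at x)" if "x \<in> S" for x
    using smooth_on_differentiable[OF assms(4) that] frechet_derivative_works by blast
  have lg: "g differentiable (at (f x))" if "x \<in> S" for x
    using smooth_on_differentiable[OF Suc.prems] that assms(3) by blast
  have "((\<lambda>x. g (f x)) has_derivative (\<lambda>v. frechet_derivative g (at (f x)) (frechet_derivative f (at x) v))) (at x)"
    if "x \<in> S" for x
    using has_derivative_compose[OF df[OF that]] lg[OF that] frechet_derivative_works by blast
  then have "((\<lambda>x. g (f x)) has_derivative
      (\<lambda>v. \<Sum>b\<in>Basis. (frechet_derivative f (at x) v \<bullet> b) *\<^sub>R frechet_derivative g (at (f x)) b)) (at x)"
    if "x \<in> S" for x
    using that by (subst linear_eq_sum_Basis[OF linear_frechet_derivative[OF lg[OF that]], symmetric])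
  then show ?case
  proof (rule C_k_on_SucI[OF assms(1)])
    fix v
    have IH: "C_k_on k S (\<lambda>x. frechet_derivative g (at (f x)) b)" for b
      using Suc.IH[OF smooth_on_derivative[OF Suc.prems]] by simp
    have C: "C_k_on k S (\<lambda>x. (frechet_derivative f (at x) v \<bullet> b) *\<^sub>R frechet_derivative g (at (f x)) b)" for b
      using smooth_on_derivative[OF assms(4)] IH
      by (intro C_k_on_bilinear[OF assms(1) bounded_bilinear_scaleR] C_k_on_const
          C_k_on_bilinear[OF assms(1) bounded_bilinear_inner]) (auto simp: smooth_on_def)
    have "C_k_on k S (\<lambda>x. \<Sum>b\<in>B. (frechet_derivative f (at x) v \<bullet> b) *\<^sub>R frechet_derivative g (at (f x)) b)"
      if "finite B" for B
      using that by induction (auto intro: C_k_on_const C_k_on_add[OF assms(1)] C)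
    then show "C_k_on k S (\<lambda>x. \<Sum>b\<in>Basis. (frechet_derivative f (at x) v \<bullet> b) *\<^sub>R frechet_derivative g (at (f x)) b)"
      by simp
  qed
qed

lemma smooth_on_compose:
  fixes f :: "'e::real_normed_vector \<Rightarrow> 'f::euclidean_space"
  assumes "open S" "open T" "f ` S \<subseteq> T" "smooth_on S f" "smooth_on T g"
  shows "smooth_on S (\<lambda>x. g (f x))"
  unfolding smooth_on_def using C_k_on_compose[OF assms] by blast

text \<open>
  The mean value theorem, first along \<open>u\<close> and then along \<open>v\<close>. The second difference on the left is
  symmetric in \<open>u\<close> and \<open>v\<close>, which is what relates the two mixed second derivatives.
\<close>

lemma second_difference_mvt:
  fixes f :: "'e::real_normed_vector \<Rightarrow> real"
  assumes f: "smooth_on (ball x r) f" and t: "t > 0" "t * (norm u + norm v) < r"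
  obtains y where "norm (y - x) \<le> t * (norm u + norm v)"
    and "f (x + t *\<^sub>R u + t *\<^sub>R v) - f (x + t *\<^sub>R u) - f (x + t *\<^sub>R v) + f x =
      t\<^sup>2 * frechet_derivative (\<lambda>z. frechet_derivative f (at z) u) (at y) v"
proof -
  let ?D = "\<lambda>z. frechet_derivative f (at z)" and ?B = "ball x r"
  have inB: "norm (a *\<^sub>R u + b *\<^sub>R v) \<le> t * (norm u + norm v)"
    "x + a *\<^sub>R u + b *\<^sub>R v \<in> ?B" if "0 \<le> a" "a \<le> t" "0 \<le> b" "b \<le> t" for a b
  proof -
    have "norm (a *\<^sub>R u + b *\<^sub>R v) \<le> a * norm u + b * norm v"
      using that norm_triangle_ineq[of "a *\<^sub>R u" "b *\<^sub>R v"] by simp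
    also have "\<dots> \<le> t * norm u + t * norm v"
      using that by (intro add_mono mult_right_mono) auto
    finally show le: "norm (a *\<^sub>R u + b *\<^sub>R v) \<le> t * (norm u + norm v)"
      by (simp add: algebra_simps)
    have "dist x (x + a *\<^sub>R u + b *\<^sub>R v) = norm (a *\<^sub>R u + b *\<^sub>R v)"
      unfolding dist_commute[of x] by (simp add: dist_norm add.assoc)
    with le t show "x + a *\<^sub>R u + b *\<^sub>R v \<in> ?B" by simp
  qed
  have line: "((\<lambda>s. h (p + s *\<^sub>R w)) has_real_derivative frechet_derivative h (at (p + s *\<^sub>R w)) w) (at s)"
    if "h differentiable (at (p + s *\<^sub>R w))" for h :: "'e \<Rightarrow> real" and p w :: 'e and s :: real
  proof -
    have l: "((\<lambda>s. p + s *\<^sub>R w) has_derivative (\<lambda>k. k *\<^sub>R w)) (at s)"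
      by (auto intro!: derivative_eq_intros)
    have "((\<lambda>s. h (p + s *\<^sub>R w)) has_derivative (\<lambda>k. frechet_derivative h (at (p + s *\<^sub>R w)) (k *\<^sub>R w))) (at s)"
      using has_derivative_compose[OF l] that frechet_derivative_works by blast
    then show ?thesis
      using linear_cmul[OF linear_frechet_derivative[OF that]]
      by (simp add: has_field_derivative_def mult_commute_abs)
  qed
  let ?g = "\<lambda>s. f ((x + t *\<^sub>R v) + s *\<^sub>R u) - f (x + s *\<^sub>R u)"
  have "(?g has_real_derivative (?D ((x + t *\<^sub>R v) + s *\<^sub>R u) u - ?D (x + s *\<^sub>R u) u)) (at s)"
    if "0 \<le> s" "s \<le> t" for s
    using inB(2)[OF that, of t] inB(2)[OF that, of 0] t
    by (intro DERIV_diff line smooth_on_differentiable[OF f]) (auto simp: algebra_simps)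
  from MVT2[OF t(1) this] obtain s where s: "0 < s" "s < t"
    "?g t - ?g 0 = t * (?D ((x + t *\<^sub>R v) + s *\<^sub>R u) u - ?D (x + s *\<^sub>R u) u)"
    by auto
  have "((\<lambda>q. ?D ((x + s *\<^sub>R u) + q *\<^sub>R v) u) has_real_derivative
      frechet_derivative (\<lambda>z. ?D z u) (at ((x + s *\<^sub>R u) + q *\<^sub>R v)) v) (at q)" if "0 \<le> q" "q \<le> t" for q
    by (intro line smooth_on_differentiable[OF smooth_on_derivative[OF f]] inB(2)) (use that s in auto)
  from MVT2[OF t(1) this] obtain q where q: "0 < q" "q < t"
    "?D ((x + s *\<^sub>R u) + t *\<^sub>R v) u - ?D ((x + s *\<^sub>R u) + 0 *\<^sub>R v) u =
      t * frechet_derivative (\<lambda>z. ?D z u) (at ((x + s *\<^sub>R u) + q *\<^sub>R v)) v"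
    by auto
  show thesis
  proof
    show "norm (x + s *\<^sub>R u + q *\<^sub>R v - x) \<le> t * (norm u + norm v)"
      using inB(1)[of s q] s q by (simp add: algebra_simps)
    show "f (x + t *\<^sub>R u + t *\<^sub>R v) - f (x + t *\<^sub>R u) - f (x + t *\<^sub>R v) + f x =
      t\<^sup>2 * frechet_derivative (\<lambda>z. frechet_derivative f (at z) u) (at (x + s *\<^sub>R u + q *\<^sub>R v)) v"
      using s(3) q(3) by (simp add: algebra_simps power2_eq_square)
  qed
qed

text \<open>
  Either mixed derivative takes, at some point within any given distance of \<open>x\<close>, the value of the same
  difference quotient. Both are continuous at \<open>x\<close>.
\<close>

lemma second_derivative_symmetric_real:
  fixes f :: "'e::real_normed_vector \<Rightarrow> real"
  assumes S: "open S" "x \<in> S" and f: "smooth_on S f"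
  shows "frechet_derivative (\<lambda>z. frechet_derivative f (at z) u) (at x) v =
    frechet_derivative (\<lambda>z. frechet_derivative f (at z) v) (at x) u" (is "?H u v x = ?H v u x")
proof -
  obtain r where r: "r > 0" "ball x r \<subseteq> S" using S openE by blast
  have f': "smooth_on (ball x r) f" using smooth_on_subset[OF f r(2)] .
  have cont: "isCont (?H u v) x" for u v
    using smooth_on_continuous[OF smooth_on_derivative[OF smooth_on_derivative[OF f']]] r(1)
    by (simp add: continuous_on_eq_continuous_at)
  define K where "K = norm u + norm v + 1"
  have K: "K > 0" by (simp add: K_def add_nonneg_pos)
  have "\<bar>?H u v x - ?H v u x\<bar> \<le> e" if "e > 0" for e
  proof -
    from cont[of u v] obtain d1 where d1: "d1 > 0" "\<And>y. dist y x < d1 \<Longrightarrow> \<bar>?H u v y - ?H u v x\<bar> < e/2"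
      using \<open>e > 0\<close> unfolding continuous_at_eps_delta by (metis dist_real_def half_gt_zero)
    from cont[of v u] obtain d2 where d2: "d2 > 0" "\<And>y. dist y x < d2 \<Longrightarrow> \<bar>?H v u y - ?H v u x\<bar> < e/2"
      using \<open>e > 0\<close> unfolding continuous_at_eps_delta by (metis dist_real_def half_gt_zero)
    define d where "d = min r (min d1 d2)"
    have d: "d > 0" "d \<le> r" "d \<le> d1" "d \<le> d2" using r d1 d2 by (auto simp: d_def)
    define t where "t = d / K / 2"
    have t: "t > 0" using d K by (simp add: t_def)
    have "t * (norm u + norm v) \<le> t * K" using t by (simp add: K_def)
    also have "t * K < d" using d K by (simp add: t_def)
    finally have tl: "t * (norm u + norm v) < d" .
    with d have tr: "t * (norm u + norm v) < r" by simp
    obtain y where y: "norm (y - x) \<le> t * (norm u + norm v)"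
      "f (x + t *\<^sub>R u + t *\<^sub>R v) - f (x + t *\<^sub>R u) - f (x + t *\<^sub>R v) + f x = t\<^sup>2 * ?H u v y"
      by (rule second_difference_mvt[OF f' t tr])
    obtain z where z: "norm (z - x) \<le> t * (norm v + norm u)"
      "f (x + t *\<^sub>R v + t *\<^sub>R u) - f (x + t *\<^sub>R v) - f (x + t *\<^sub>R u) + f x = t\<^sup>2 * ?H v u z"
      by (rule second_difference_mvt[OF f' t tr[unfolded add.commute[of "norm u"]]])
    have "t\<^sup>2 * ?H u v y = t\<^sup>2 * ?H v u z" using y(2) z(2) by (simp add: algebra_simps)
    then have "?H u v y = ?H v u z" using t by simp
    moreover have "\<bar>?H u v y - ?H u v x\<bar> < e/2" using d1(2)[of y] y(1) tl d by (simp add: dist_norm)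
    moreover have "\<bar>?H v u z - ?H v u x\<bar> < e/2" using d2(2)[of z] z(1) tl d by (simp add: dist_norm add.commute)
    ultimately show ?thesis by linarith
  qed
  then have "\<bar>?H u v x - ?H v u x\<bar> \<le> 0" by (rule field_le_epsilon) simp
  then show ?thesis by linarith
qed

lemma second_derivative_symmetric:
  fixes f :: "'e::real_normed_vector \<Rightarrow> 'f::euclidean_space"
  assumes S: "open S" "x \<in> S" and f: "smooth_on S f"
  shows "frechet_derivative (\<lambda>z. frechet_derivative f (at z) u) (at x) v =
    frechet_derivative (\<lambda>z. frechet_derivative f (at z) v) (at x) u"
proof (rule euclidean_eqI)
  fix b :: 'f assume "b \<in> Basis"
  have comp: "frechet_derivative (\<lambda>z. h z \<bullet> b) (at z) w = frechet_derivative h (at z) w \<bullet> b"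
    if "h differentiable (at z)" for h :: "'e \<Rightarrow> 'f" and z w
    by (rule fun_cong[OF frechet_derivative_at[OF
          has_derivative_inner_left[OF that[unfolded frechet_derivative_works]], symmetric]])
  have twice: "frechet_derivative (\<lambda>z. frechet_derivative (\<lambda>z. f z \<bullet> b) (at z) a) (at x) w =
      frechet_derivative (\<lambda>z. frechet_derivative f (at z) a) (at x) w \<bullet> b" for a w
  proof -
    have d: "(\<lambda>z. frechet_derivative f (at z) a) differentiable (at x)"
      using smooth_on_differentiable[OF smooth_on_derivative[OF f] S(2)] .
    then have "((\<lambda>z. frechet_derivative f (at z) a \<bullet> b) has_derivative
        (\<lambda>w. frechet_derivative (\<lambda>z. frechet_derivative f (at z) a) (at x) w \<bullet> b)) (at x)"
      using has_derivative_inner_left frechet_derivative_works by blast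
    then have "((\<lambda>z. frechet_derivative (\<lambda>z. f z \<bullet> b) (at z) a) has_derivative
        (\<lambda>w. frechet_derivative (\<lambda>z. frechet_derivative f (at z) a) (at x) w \<bullet> b)) (at x)"
      by (rule has_derivative_transform_within_open[OF _ S])
        (simp add: comp smooth_on_differentiable[OF f])
    then show ?thesis by (rule fun_cong[OF frechet_derivative_at[symmetric]])
  qed
  have "smooth_on S (\<lambda>z. f z \<bullet> b)" by (intro smooth_on_inner S f smooth_on_const)
  from second_derivative_symmetric_real[OF S this, of u v]
  show "frechet_derivative (\<lambda>z. frechet_derivative f (at z) u) (at x) v \<bullet> b =
    frechet_derivative (\<lambda>z. frechet_derivative f (at z) v) (at x) u \<bullet> b"
    by (simp add: twice)
qed

text \<open>
  The product rule behind differentiating an identity such as \<open>Df(E) = 0\<close>, which holds when the field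
  \<open>E\<close> consists of kernel vectors of \<open>Df\<close>.
\<close>

lemma has_derivative_derivative_along:
  fixes f :: "'e::euclidean_space \<Rightarrow> 'f::real_normed_vector"
  assumes S: "open S" "x \<in> S" and f: "smooth_on S f" and E: "(E has_derivative E') (at x)"
  shows "((\<lambda>z. frechet_derivative f (at z) (E z)) has_derivative
    (\<lambda>v. frechet_derivative (\<lambda>z. frechet_derivative f (at z) (E x)) (at x) v +
      frechet_derivative f (at x) (E' v))) (at x)"
proof -
  let ?D = "\<lambda>z. frechet_derivative f (at z)"
  have lin: "linear (?D z)" if "z \<in> S" for z
    using linear_frechet_derivative smooth_on_differentiable[OF f that] by blast
  have dD: "((\<lambda>z. ?D z w) has_derivative frechet_derivative (\<lambda>z. ?D z w) (at x)) (at x)" for w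
    using smooth_on_differentiable[OF smooth_on_derivative[OF f] S(2)] frechet_derivative_works by blast
  have dsum: "((\<lambda>z. \<Sum>b\<in>Basis. (G z \<bullet> b) *\<^sub>R ?D z b) has_derivative
     (\<lambda>v. \<Sum>b\<in>Basis. (G x \<bullet> b) *\<^sub>R frechet_derivative (\<lambda>z. ?D z b) (at x) v + (G' v \<bullet> b) *\<^sub>R ?D x b)) (at x)"
    if "(G has_derivative G') (at x)" for G G'
    by (intro has_derivative_sum has_derivative_scaleR has_derivative_inner_left that dD)
  have tr: "((\<lambda>z. ?D z (G z)) has_derivative
     (\<lambda>v. \<Sum>b\<in>Basis. (G x \<bullet> b) *\<^sub>R frechet_derivative (\<lambda>z. ?D z b) (at x) v + (G' v \<bullet> b) *\<^sub>R ?D x b)) (at x)"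
    if "(G has_derivative G') (at x)" for G G'
    by (rule has_derivative_transform_within_open[OF dsum[OF that] S])
      (simp add: linear_eq_sum_Basis[OF lin, symmetric])
  have "frechet_derivative (\<lambda>z. ?D z (E x)) (at x) = (\<lambda>v. \<Sum>b\<in>Basis. (E x \<bullet> b) *\<^sub>R frechet_derivative (\<lambda>z. ?D z b) (at x) v)"
    using frechet_derivative_at[OF tr[OF has_derivative_const[of "E x"]]] by simp
  with tr[OF E] show ?thesis
    by (simp add: sum.distrib linear_eq_sum_Basis[OF lin[OF S(2)], of "E' _", symmetric])
qed

section \<open>Scalar products on Euclidean spaces\<close>

locale scalar_product =
  fixes g :: "'e::euclidean_space \<Rightarrow> 'e \<Rightarrow> real"
  assumes bilin: "bilinear g"
    and sym: "g x y = g y x"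
    and pos: "x \<noteq> 0 \<Longrightarrow> g x x > 0"
begin

lemma linear_left: "linear (\<lambda>x. g x y)" and linear_right: "linear (g x)"
  using bilin by (auto simp: bilinear_def)

lemmas add_left = linear_add[OF linear_left]
lemmas add_right = linear_add[OF linear_right]
lemmas diff_left = linear_diff[OF linear_left]
lemmas diff_right = linear_diff[OF linear_right]
lemmas minus_left = linear_neg[OF linear_left]
lemmas minus_right = linear_neg[OF linear_right]
lemmas scale_left = linear_cmul[OF linear_left, unfolded real_scaleR_def]
lemmas scale_right = linear_cmul[OF linear_right, unfolded real_scaleR_def]
lemmas zero_left = linear_0[OF linear_left]
lemmas zero_right = linear_0[OF linear_right]
lemmas sum_left = linear_sum[OF linear_left]
lemmas sum_right = linear_sum[OF linear_right]

lemmas form_simps = add_left add_right diff_left diff_right minus_left minus_right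
  scale_left scale_right zero_left zero_right

lemma nonneg: "g x x \<ge> 0"
  by (cases "x = 0") (auto simp: zero_left dest: pos)

lemma eq_0_iff: "g x x = 0 \<longleftrightarrow> x = 0"
  by (metis less_irrefl pos zero_left)

lemma orthogonal_to_span: "x \<in> span S \<Longrightarrow> (\<And>w. w \<in> S \<Longrightarrow> g v w = 0) \<Longrightarrow> g v x = 0"
  using linear_eq_0_on_span[OF linear_right] by blast

lemma independent_orthonormal:
  assumes "\<forall>i\<in>I. \<forall>j\<in>I. g (X i) (X j) = (if i = j then 1 else 0)" "finite I"
  shows "inj_on X I" "independent (X ` I)"
proof -
  show inj: "inj_on X I"
    by (rule inj_onI) (metis assms(1) zero_neq_one)
  have "u i = 0" if u: "(\<Sum>i\<in>I. u i *\<^sub>R X i) = 0" and i: "i \<in> I" for u i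
  proof -
    have "0 = g (\<Sum>i\<in>I. u i *\<^sub>R X i) (X i)" by (simp add: u zero_left)
    also have "\<dots> = (\<Sum>j\<in>I. if j = i then u j else 0)"
      unfolding sum_left by (rule sum.cong) (use assms i in \<open>auto simp: scale_left\<close>)
    also have "\<dots> = u i" using i assms(2) by simp
    finally show ?thesis by simp
  qed
  then have "(\<Sum>v\<in>X ` I. a v *\<^sub>R v) = 0 \<Longrightarrow> \<forall>v\<in>X ` I. a v = 0" for a
    by (auto simp: sum.reindex[OF inj])
  then show "independent (X ` I)"
    by (subst independent_if_scalars_zero) (use assms(2) in auto)
qed

text \<open>
  Gram--Schmidt, adding one vector at a time until the dimension is exhausted.
\<close>

lemma orthonormal_basis_exists:
  assumes "subspace W"
  shows "\<exists>X. is_orthonormal_basis g W X"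
proof -
  have "\<exists>X. X ` {1..n} \<subseteq> W \<and> (\<forall>i\<in>{1..n}. \<forall>j\<in>{1..n}. g (X i) (X j) = (if i = j then 1 else 0))"
    if "n \<le> dim W" for n
    using that
  proof (induction n)
    case (Suc n)
    then obtain X :: "nat \<Rightarrow> 'e" where X: "X ` {1..n} \<subseteq> W"
      "\<And>i j. i \<in> {1..n} \<Longrightarrow> j \<in> {1..n} \<Longrightarrow> g (X i) (X j) = (if i = j then 1 else 0)" by auto
    have "dim (X ` {1..n}) \<le> n"
      using dim_le_card'[of "X ` {1..n}"] card_image_le[of "{1..n}" X] by simp
    then have "\<not> W \<subseteq> span (X ` {1..n})"
      using Suc.prems dim_subset[of W "span (X ` {1..n})"] by auto
    then obtain w where w: "w \<in> W" "w \<notin> span (X ` {1..n})" by blast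
    define p where "p = (\<Sum>i=1..n. g w (X i) *\<^sub>R X i)"
    have p: "p \<in> span (X ` {1..n})" unfolding p_def
      by (intro span_sum span_scale span_base) auto
    have "p \<in> W" using p X(1) assms span_minimal by blast
    have "w - p \<noteq> 0" using p w by auto
    then have gp: "g (w - p) (w - p) > 0" by (rule pos)
    have orth: "g (w - p) (X j) = 0" if "j \<in> {1..n}" for j
    proof -
      have "g p (X j) = (\<Sum>i=1..n. if i = j then g w (X i) else 0)"
        unfolding p_def sum_left by (rule sum.cong) (use X(2) that in \<open>auto simp: scale_left\<close>)
      then show ?thesis using that by (simp add: diff_left)
    qed
    define e where "e = (1 / sqrt (g (w - p) (w - p))) *\<^sub>R (w - p)"
    have "e \<in> W" unfolding e_def using \<open>p \<in> W\<close> w(1) assms by (intro subspace_scale subspace_diff)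
    moreover have "g e e = 1" using gp by (simp add: e_def scale_left scale_right)
    moreover have "g e (X j) = 0" "g (X j) e = 0" if "j \<in> {1..n}" for j
      using orth[OF that] sym[of "X j"] by (simp_all add: e_def scale_left)
    ultimately show ?case using X
      by (intro exI[of _ "X(Suc n := e)"]) (auto simp: atLeastAtMostSuc_conv image_iff)
  qed auto
  from this[of "dim W"] obtain X :: "nat \<Rightarrow> 'e" where X: "X ` {1..dim W} \<subseteq> W"
      "\<forall>i\<in>{1..dim W}. \<forall>j\<in>{1..dim W}. g (X i) (X j) = (if i = j then 1 else 0)" by auto
  have "card (X ` {1..dim W}) = dim W"
    using independent_orthonormal(1)[OF X(2)] by (simp add: card_image)
  then have "W \<subseteq> span (X ` {1..dim W})"
    using card_ge_dim_independent[OF X(1) independent_orthonormal(2)[OF X(2)]] by simp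
  then have "span (X ` {1..dim W}) = W"
    using X(1) assms span_minimal by blast
  then show ?thesis using X unfolding is_orthonormal_basis_def by blast
qed

lemma orthonormal_basis: "subspace W \<Longrightarrow> is_orthonormal_basis g W (orthonormal_basis g W)"
  unfolding orthonormal_basis_def using someI_ex[OF orthonormal_basis_exists] by blast

context
  fixes W :: "'e set" and X :: "nat \<Rightarrow> 'e"
  assumes onb: "is_orthonormal_basis g W X"
begin

lemma onb_in: "i \<in> {1..dim W} \<Longrightarrow> X i \<in> W"
  and onb_span: "span (X ` {1..dim W}) = W"
  and onb_orthonormal: "i \<in> {1..dim W} \<Longrightarrow> j \<in> {1..dim W} \<Longrightarrow> g (X i) (X j) = (if i = j then 1 else 0)"
  using onb unfolding is_orthonormal_basis_def by auto

lemma onb_subspace: "subspace W"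
  using onb_span subspace_span by metis

lemma onb_projection:
  shows "(\<Sum>i=1..dim W. g v (X i) *\<^sub>R X i) \<in> W"
    and "w \<in> W \<Longrightarrow> g (v - (\<Sum>i=1..dim W. g v (X i) *\<^sub>R X i)) w = 0"
proof -
  let ?p = "\<Sum>i=1..dim W. g v (X i) *\<^sub>R X i"
  show "?p \<in> W" by (intro subspace_sum subspace_scale onb_subspace onb_in)
  have "g (v - ?p) (X j) = 0" if "j \<in> {1..dim W}" for j
  proof -
    have "g ?p (X j) = (\<Sum>i=1..dim W. if i = j then g v (X i) else 0)"
      unfolding sum_left by (rule sum.cong) (use onb_orthonormal that in \<open>auto simp: scale_left\<close>)
    then show ?thesis using that by (simp add: diff_left)
  qed
  then show "w \<in> W \<Longrightarrow> g (v - ?p) w = 0"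
    using orthogonal_to_span[of w "X ` {1..dim W}"] unfolding onb_span by blast
qed

lemma orthogonal_both_0: "v \<in> W \<Longrightarrow> (\<And>w. w \<in> W \<Longrightarrow> g v w = 0) \<Longrightarrow> v = 0"
  using eq_0_iff by blast

lemma onb_expansion: "v \<in> W \<Longrightarrow> v = (\<Sum>i=1..dim W. g v (X i) *\<^sub>R X i)"
  using orthogonal_both_0[of "v - (\<Sum>i=1..dim W. g v (X i) *\<^sub>R X i)"] onb_projection[where v = v]
    subspace_diff[OF onb_subspace] by auto

lemma parseval: "v \<in> W \<Longrightarrow> (\<Sum>i=1..dim W. (g v (X i))\<^sup>2) = g v v"
proof -
  assume v: "v \<in> W"
  have "g v v = g v (\<Sum>i=1..dim W. g v (X i) *\<^sub>R X i)" using onb_expansion[OF v] by simp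
  then show ?thesis by (simp add: sum_right scale_right power2_eq_square)
qed

lemma riesz_on:
  fixes \<phi> :: "'e \<Rightarrow> real"
  assumes "linear \<phi>"
  shows "\<exists>!v. v \<in> W \<and> (\<forall>w\<in>W. g v w = \<phi> w)"
proof (rule ex_ex1I)
  let ?v = "\<Sum>i=1..dim W. \<phi> (X i) *\<^sub>R X i"
  have "?v \<in> W" by (intro subspace_sum subspace_scale onb_subspace onb_in)
  moreover have "g ?v w = \<phi> w" if "w \<in> W" for w
  proof -
    have "\<phi> w = \<phi> (\<Sum>i=1..dim W. g w (X i) *\<^sub>R X i)" using onb_expansion[OF that] by simp
    also have "\<dots> = g ?v w"
      by (simp add: linear_sum[OF assms] linear_cmul[OF assms] sum_left scale_left sym[of w] mult.commute)
    finally show ?thesis by simp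
  qed
  ultimately show "\<exists>v. v \<in> W \<and> (\<forall>w\<in>W. g v w = \<phi> w)" by blast
next
  fix v v' assume "v \<in> W \<and> (\<forall>w\<in>W. g v w = \<phi> w)" "v' \<in> W \<and> (\<forall>w\<in>W. g v' w = \<phi> w)"
  then show "v = v'"
    using orthogonal_both_0[of "v - v'"] subspace_diff[OF onb_subspace] by (auto simp: diff_left)
qed

end

lemma orth_proj_eqI:
  assumes "subspace W" "u \<in> W" "\<And>w. w \<in> W \<Longrightarrow> g (v - u) w = 0"
  shows "orth_proj g W v = u"
  unfolding orth_proj_def
proof (rule the_equality)
  show "u \<in> W \<and> (\<forall>w\<in>W. g (v - u) w = 0)" using assms by blast
next
  fix u' assume u': "u' \<in> W \<and> (\<forall>w\<in>W. g (v - u') w = 0)"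
  have "u' - u \<in> W" using u' assms subspace_diff by blast
  then have "g (u' - u) (u' - u) = 0"
    using u' assms(3) by (metis (no_types, lifting) diff_left diff_self diff_diff_eq2 add_diff_cancel_left' add.commute)
  then show "u' = u" by (simp add: eq_0_iff)
qed

lemma orth_proj:
  assumes "subspace W"
  shows "orth_proj g W v \<in> W" and "w \<in> W \<Longrightarrow> g (v - orth_proj g W v) w = 0"
proof -
  let ?p = "\<Sum>i=1..dim W. g v (orthonormal_basis g W i) *\<^sub>R orthonormal_basis g W i"
  note p = onb_projection[OF orthonormal_basis[OF assms], where v = v]
  have "orth_proj g W v = ?p" by (rule orth_proj_eqI) (use assms p in auto)
  then show "orth_proj g W v \<in> W" "w \<in> W \<Longrightarrow> g (v - orth_proj g W v) w = 0" using p by auto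
qed

lemma orth_proj_form: "subspace W \<Longrightarrow> w \<in> W \<Longrightarrow> g (orth_proj g W v) w = g v w"
  using orth_proj(2)[of W w v] by (simp add: diff_left)

lemma orth_proj_id: "subspace W \<Longrightarrow> w \<in> W \<Longrightarrow> orth_proj g W w = w"
  by (intro orth_proj_eqI) (auto simp: zero_left)

lemma linear_orth_proj:
  assumes "subspace W" shows "linear (orth_proj g W)"
proof (rule linearI)
  show "orth_proj g W (x + y) = orth_proj g W x + orth_proj g W y" for x y
    by (rule orth_proj_eqI)
      (use assms orth_proj[OF assms] in \<open>auto intro: subspace_add simp: orth_proj_form form_simps\<close>)
  show "orth_proj g W (c *\<^sub>R x) = c *\<^sub>R orth_proj g W x" for c x
    by (rule orth_proj_eqI)
      (use assms orth_proj[OF assms] in \<open>auto intro: subspace_scale simp: orth_proj_form form_simps\<close>)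
qed

text \<open>
  If \<open>v \<in> W\<close> represents \<open>\<phi>\<close>, the two sides are the squared lengths of the orthogonal projection of
  \<open>v\<close> to \<open>L\<close> and of \<open>v\<close> itself.
\<close>

lemma sum_squares_onb_mono:
  fixes \<phi> :: "'e \<Rightarrow> real"
  assumes L: "is_orthonormal_basis g L Y" and W: "is_orthonormal_basis g W X"
    and "L \<subseteq> W" and "linear \<phi>"
  shows "(\<Sum>i=1..dim L. (\<phi> (Y i))\<^sup>2) \<le> (\<Sum>i=1..dim W. (\<phi> (X i))\<^sup>2)"
proof -
  obtain v where v: "v \<in> W" "\<And>w. w \<in> W \<Longrightarrow> g v w = \<phi> w"
    using riesz_on[OF W \<open>linear \<phi>\<close>] by blast
  let ?P = "orth_proj g L v"
  have PL: "subspace L" by (rule onb_subspace[OF L])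
  have "g (Y i) ?P = \<phi> (Y i)" if "i \<in> {1..dim L}" for i
    using onb_in[OF L that] v(2) \<open>L \<subseteq> W\<close> orth_proj_form[OF PL, of "Y i" v] sym[of "Y i"] by auto
  then have "(\<Sum>i=1..dim L. (\<phi> (Y i))\<^sup>2) = (\<Sum>i=1..dim L. (g ?P (Y i))\<^sup>2)"
    by (intro sum.cong) (auto simp: sym)
  also have "\<dots> = g ?P ?P" by (rule parseval[OF L orth_proj(1)[OF PL]])
  also have "\<dots> \<le> g v v"
  proof -
    have "g v v = g (v - ?P) (v - ?P) + g ?P ?P"
      using orth_proj(2)[OF PL orth_proj(1)[OF PL], of v v] sym[of v ?P]
      by (simp add: diff_left diff_right)
    then show ?thesis using nonneg[of "v - ?P"] by simp
  qed
  also have "\<dots> = (\<Sum>i=1..dim W. (g v (X i))\<^sup>2)" by (rule parseval[OF W v(1), symmetric])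
  also have "\<dots> = (\<Sum>i=1..dim W. (\<phi> (X i))\<^sup>2)"
    by (intro sum.cong) (use v(2) onb_in[OF W] in auto)
  finally show ?thesis .
qed

lemma sum_squares_bilinear_onb_mono:
  fixes a :: "'e \<Rightarrow> 'e \<Rightarrow> real"
  assumes L: "is_orthonormal_basis g L Y" and W: "is_orthonormal_basis g W X"
    and "L \<subseteq> W" and bil: "\<And>x. linear (a x)" "\<And>y. linear (\<lambda>x. a x y)"
  shows "(\<Sum>i=1..dim L. \<Sum>j=1..dim L. (a (Y i) (Y j))\<^sup>2) \<le> (\<Sum>i=1..dim W. \<Sum>j=1..dim W. (a (X i) (X j))\<^sup>2)"
proof -
  have "(\<Sum>i=1..dim L. \<Sum>j=1..dim L. (a (Y i) (Y j))\<^sup>2) \<le> (\<Sum>i=1..dim L. \<Sum>j=1..dim W. (a (Y i) (X j))\<^sup>2)"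
    by (intro sum_mono sum_squares_onb_mono[OF assms(1-3)] bil)
  also have "\<dots> = (\<Sum>j=1..dim W. \<Sum>i=1..dim L. (a (Y i) (X j))\<^sup>2)" by (rule sum.swap)
  also have "\<dots> \<le> (\<Sum>j=1..dim W. \<Sum>i=1..dim W. (a (X i) (X j))\<^sup>2)"
    by (intro sum_mono sum_squares_onb_mono[OF assms(1-3)] bil)
  also have "\<dots> = (\<Sum>i=1..dim W. \<Sum>j=1..dim W. (a (X i) (X j))\<^sup>2)" by (rule sum.swap)
  finally show ?thesis .
qed

lemma hyperplanes_nonempty:
  fixes W :: "'e set"
  assumes "subspace W" shows "hyperplanes W \<noteq> {}"
proof -
  let ?X = "orthonormal_basis g W"
  note onb = orthonormal_basis[OF assms]
  let ?I = "{1..dim W - 1}"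
  have sub: "?X ` ?I \<subseteq> ?X ` {1..dim W}" by auto
  have o: "\<forall>i\<in>?I. \<forall>j\<in>?I. g (?X i) (?X j) = (if i = j then 1 else 0)"
    using onb_orthonormal[OF onb] by auto
  have "dim (span (?X ` ?I)) = dim W - 1"
    using dim_eq_card_independent[OF independent_orthonormal(2)[OF o]] independent_orthonormal(1)[OF o]
    by (simp add: card_image)
  moreover have "span (?X ` ?I) \<subseteq> W"
    using span_mono[OF sub] onb_span[OF onb] by blast
  ultimately show ?thesis unfolding hyperplanes_def by (metis (mono_tags, lifting) empty_Collect_eq subspace_span)
qed

end

section \<open>Smooth families of scalar products\<close>

text \<open>
  Induction on the test space: enlarging it by a basis vector \<open>c\<close> changes the solution by a multiple of
  the component of \<open>c\<close> orthogonal to the old space. Only nonvanishing scalar functions get inverted, so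
  no smoothness of matrix inversion is involved.
\<close>

lemma smooth_riesz_on_span:
  fixes G :: "'x::real_normed_vector \<Rightarrow> 'e::euclidean_space \<Rightarrow> 'e \<Rightarrow> real"
  assumes V: "open V" and G: "\<And>x. x \<in> V \<Longrightarrow> scalar_product (G x)"
    and sG: "\<And>b b'. b \<in> Basis \<Longrightarrow> b' \<in> Basis \<Longrightarrow> smooth_on V (\<lambda>x. G x b b')"
    and S: "S \<subseteq> Basis" and h: "\<And>b. b \<in> S \<Longrightarrow> smooth_on V (\<lambda>x. h x b)"
  shows "\<exists>E. smooth_on V E \<and> (\<forall>x\<in>V. E x \<in> span S \<and> (\<forall>b\<in>S. G x (E x) b = h x b))"
proof -
  have "finite S" using S finite_Basis finite_subset by blast
  from this S h show ?thesis
  proof (induction S arbitrary: h)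
    case empty
    show ?case by (intro exI[of _ "\<lambda>x. 0"]) (simp add: smooth_on_const)
  next
    case (insert c S)
    have c: "c \<in> Basis" and SB: "S \<subseteq> Basis" using insert.prems by auto
    have sGE: "smooth_on V (\<lambda>x. G x (E x) c)" if "smooth_on V E" for E
    proof (rule smooth_on_cong[OF V])
      show "smooth_on V (\<lambda>x. \<Sum>b\<in>Basis. (E x \<bullet> b) * G x b c)"
        by (intro smooth_on_sum smooth_on_mult smooth_on_inner V that smooth_on_const sG c)
      show "(\<Sum>b\<in>Basis. (E x \<bullet> b) * G x b c) = G x (E x) c" if "x \<in> V" for x
        using linear_eq_sum_Basis[OF scalar_product.linear_left[OF G[OF that]], of "E x" c] by simp
    qed
    obtain C where C: "smooth_on V C" "\<And>x. x \<in> V \<Longrightarrow> C x \<in> span S"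
      "\<And>x b. x \<in> V \<Longrightarrow> b \<in> S \<Longrightarrow> G x (C x) b = G x c b"
      using insert.IH[where h = "\<lambda>x b. G x c b"] SB c sG by blast
    obtain E where E: "smooth_on V E" "\<And>x. x \<in> V \<Longrightarrow> E x \<in> span S"
      "\<And>x b. x \<in> V \<Longrightarrow> b \<in> S \<Longrightarrow> G x (E x) b = h x b"
      using insert.IH[where h = h] SB insert.prems by blast
    define d where "d x = c - C x" for x
    have sd: "smooth_on V d" unfolding d_def by (intro smooth_on_diff V smooth_on_const C)
    have cS: "c \<notin> span S"
      using independent_insert[of c S] independent_mono[OF independent_Basis insert.prems(1)] insert.hyps by auto
    have dc: "G x (d x) c \<noteq> 0" if x: "x \<in> V" for x
    proof -
      interpret scalar_product "G x" by (rule G[OF x])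
      have "d x \<noteq> 0" using cS C(2)[OF x] by (auto simp: d_def)
      then have "G x (d x) (d x) > 0" by (rule pos)
      moreover have "G x (d x) b = 0" if "b \<in> S" for b
        using C(3)[OF x that] by (simp add: d_def diff_left)
      then have "G x (d x) (C x) = 0" using orthogonal_to_span[OF C(2)[OF x]] by blast
      ultimately show ?thesis by (simp add: d_def diff_right)
    qed
    define l where "l x = (h x c - G x (E x) c) * inverse (G x (d x) c)" for x
    have sl: "smooth_on V l" unfolding l_def
      by (intro smooth_on_mult smooth_on_diff smooth_on_inverse V sGE sd E dc insert.prems(2)) simp
    have "E x + l x *\<^sub>R d x \<in> span (insert c S) \<and> (\<forall>b\<in>insert c S. G x (E x + l x *\<^sub>R d x) b = h x b)"
      if x: "x \<in> V" for x
    proof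
      interpret scalar_product "G x" by (rule G[OF x])
      show "E x + l x *\<^sub>R d x \<in> span (insert c S)"
      proof -
        have "E x \<in> span (insert c S)" "C x \<in> span (insert c S)"
          using E(2)[OF x] C(2)[OF x] span_mono[of S "insert c S"] by auto
        then show ?thesis
          unfolding d_def by (intro span_add span_scale span_diff) (simp_all add: span_base)
      qed
      show "\<forall>b\<in>insert c S. G x (E x + l x *\<^sub>R d x) b = h x b"
      proof
        have d0: "G x (d x) b = 0" if "b \<in> S" for b
          using C(3)[OF x that] by (simp add: d_def diff_left)
        fix b assume "b \<in> insert c S"
        then show "G x (E x + l x *\<^sub>R d x) b = h x b"
          using dc[OF x] E(3)[OF x] d0 by (auto simp: add_left scale_left l_def mult.assoc)
      qed
    qed
    then show ?case
      using smooth_on_add[OF V E(1) smooth_on_scaleR[OF V sl sd]] by blast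
  qed
qed

text \<open>
  A field that is known only through its scalar products, such as an orthogonal projection, is smooth
  as soon as these are.
\<close>

lemma smooth_riesz:
  fixes G :: "'x::real_normed_vector \<Rightarrow> 'e::euclidean_space \<Rightarrow> 'e \<Rightarrow> real"
  assumes V: "open V" and G: "\<And>x. x \<in> V \<Longrightarrow> scalar_product (G x)"
    and sG: "\<And>b b'. b \<in> Basis \<Longrightarrow> b' \<in> Basis \<Longrightarrow> smooth_on V (\<lambda>x. G x b b')"
    and E: "\<And>b. b \<in> Basis \<Longrightarrow> smooth_on V (\<lambda>x. G x (E x) b)"
  shows "smooth_on V E"
proof -
  obtain E' where E': "smooth_on V E'" "\<And>x b. x \<in> V \<Longrightarrow> b \<in> Basis \<Longrightarrow> G x (E' x) b = G x (E x) b"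
    using smooth_riesz_on_span[OF V G sG order_refl, where h = "\<lambda>x b. G x (E x) b"] E by blast
  have "E' x = E x" if x: "x \<in> V" for x
  proof -
    interpret scalar_product "G x" by (rule G[OF x])
    have "G x (E' x - E x) b = 0" if "b \<in> Basis" for b
      using E'(2)[OF x that] by (simp add: diff_left)
    then have "G x (E' x - E x) (E' x - E x) = 0"
      using orthogonal_to_span[of _ Basis] by (simp add: span_Basis)
    then show ?thesis by (simp add: eq_0_iff)
  qed
  then show ?thesis using smooth_on_cong[OF V _ E'(1)] by blast
qed

section \<open>Charts\<close>

lemma frechet_derivative_chain:
  assumes "f differentiable (at x)" "g differentiable (at (f x))"
  shows "frechet_derivative (g \<circ> f) (at x) v = frechet_derivative g (at (f x)) (frechet_derivative f (at x) v)"
  using frechet_derivative_compose[OF assms] by simp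

lemma frechet_derivative_cong_open:
  assumes "open S" "x \<in> S" "\<And>y. y \<in> S \<Longrightarrow> f y = g y"
  shows "frechet_derivative f (at x) = frechet_derivative g (at x)"
proof -
  have "(f has_derivative D) (at x) \<longleftrightarrow> (g has_derivative D) (at x)" for D
    using has_derivative_transform_within_open[OF _ assms(1,2)] assms(3) by metis
  then show ?thesis unfolding frechet_derivative_def by simp
qed

lemma differentiable_cong_open:
  assumes "open S" "x \<in> S" "\<And>y. y \<in> S \<Longrightarrow> f y = g y" "f differentiable (at x)"
  shows "g differentiable (at x)"
  using assms has_derivative_transform_within_open unfolding differentiable_def by metis

context
  fixes M :: "('a::{t2_space,second_countable_topology}, 'e::euclidean_space, 'm) manifold_scheme"
  assumes M: "smooth_manifold M"
begin

lemma in_chart_dom: "p \<in> chart_dom M p"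
  and open_chart_dom: "open (chart_dom M p)"
  and open_chart_image: "open (chart M p ` chart_dom M p)"
  and chart_homeomorphism: "homeomorphism (chart_dom M p) (chart M p ` chart_dom M p) (chart M p) (chart_inv M p)"
  and smooth_transition: "smooth_on (chart M p ` (chart_dom M p \<inter> chart_dom M q)) (chart M q \<circ> chart_inv M p)"
  using M unfolding smooth_manifold_def by blast+

lemma chart_inv_chart: "q \<in> chart_dom M p \<Longrightarrow> chart_inv M p (chart M p q) = q"
  using chart_homeomorphism[of p] by (auto simp: homeomorphism_def)

lemma chart_chart_inv: "y \<in> chart M p ` chart_dom M p \<Longrightarrow> chart M p (chart_inv M p y) = y"
  using chart_homeomorphism[of p] by (auto simp: homeomorphism_def)

lemma chart_inv_in: "y \<in> chart M p ` chart_dom M p \<Longrightarrow> chart_inv M p y \<in> chart_dom M p"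
  using chart_inv_chart by auto

lemma open_chart_image_subset:
  assumes "open U" "U \<subseteq> chart_dom M p" shows "open (chart M p ` U)"
proof -
  have "openin (top_of_set (chart M p ` chart_dom M p)) (chart M p ` U)"
    using homeomorphism_imp_open_map[OF chart_homeomorphism] assms openin_open_eq[OF open_chart_dom] by blast
  then show ?thesis using open_chart_image openin_open_eq by blast
qed

lemma open_chart_inv_image:
  assumes "open D" "D \<subseteq> chart M p ` chart_dom M p" shows "open (chart_inv M p ` D)"
proof -
  have "openin (top_of_set (chart_dom M p)) (chart_inv M p ` D)"
    using homeomorphism_imp_open_map[OF homeomorphism_symD[OF chart_homeomorphism]]
      assms openin_open_eq[OF open_chart_image] by blast
  then show ?thesis using open_chart_dom openin_open_eq by blast
qed

lemma smooth_near_iff: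
  "smooth_near M p f \<longleftrightarrow> (\<exists>D. open D \<and> chart M p p \<in> D \<and> D \<subseteq> chart M p ` chart_dom M p \<and>
     smooth_on D (f \<circ> chart_inv M p))"
proof
  assume "smooth_near M p f"
  then obtain U where "open U" "p \<in> U" "U \<subseteq> chart_dom M p" "smooth_on (chart M p ` U) (f \<circ> chart_inv M p)"
    unfolding smooth_near_def by blast
  then show "\<exists>D. open D \<and> chart M p p \<in> D \<and> D \<subseteq> chart M p ` chart_dom M p \<and>
     smooth_on D (f \<circ> chart_inv M p)"
    using open_chart_image_subset by (intro exI[of _ "chart M p ` U"]) auto
next
  assume "\<exists>D. open D \<and> chart M p p \<in> D \<and> D \<subseteq> chart M p ` chart_dom M p \<and>
     smooth_on D (f \<circ> chart_inv M p)"
  then obtain D where D: "open D" "chart M p p \<in> D" "D \<subseteq> chart M p ` chart_dom M p"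
     "smooth_on D (f \<circ> chart_inv M p)" by blast
  have "chart M p ` chart_inv M p ` D = D"
    using chart_chart_inv D(3) by (force simp: image_iff)
  moreover have "p \<in> chart_inv M p ` D"
    using D(2) chart_inv_chart[OF in_chart_dom, of p] by (metis image_eqI)
  ultimately show "smooth_near M p f"
    unfolding smooth_near_def using D chart_inv_in open_chart_inv_image
    by (intro exI[of _ "chart_inv M p ` D"]) auto
qed

lemma smooth_near_const: "smooth_near M p (\<lambda>q. c)"
  unfolding smooth_near_iff o_def using open_chart_image in_chart_dom smooth_on_const by blast

lemma fun_diff_const: "fun_diff M (\<lambda>q. c) p v = 0"
  by (simp add: fun_diff_def o_def)

lemma smooth_near_differentiable:
  "smooth_near M p f \<Longrightarrow> (f \<circ> chart_inv M p) differentiable (at (chart M p p))"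
  unfolding smooth_near_iff using smooth_on_differentiable by blast

text \<open>
  The vector \<open>extend_vec M p v q\<close> is the one at \<open>q\<close> with components \<open>v\<close> in the chart at \<open>p\<close>, so the
  chain rule for the transition map gives the differential at \<open>q\<close> in terms of the chart at \<open>p\<close>.
\<close>

lemma fun_diff_chart_change:
  assumes q: "q \<in> chart_dom M p" and \<phi>: "(\<phi> \<circ> chart_inv M q) differentiable (at (chart M q q))"
  shows "(\<phi> \<circ> chart_inv M p) differentiable (at (chart M p q))"
    and "frechet_derivative (\<phi> \<circ> chart_inv M p) (at (chart M p q)) v = fun_diff M \<phi> q (extend_vec M p v q)"
proof -
  let ?S = "chart M p ` (chart_dom M p \<inter> chart_dom M q)"
  let ?t = "chart M q \<circ> chart_inv M p"
  have S: "open ?S" "chart M p q \<in> ?S"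
    using open_chart_image_subset[of "chart_dom M p \<inter> chart_dom M q" p] open_chart_dom q in_chart_dom
    by auto
  have t: "?t (chart M p q) = chart M q q" by (simp add: chart_inv_chart q)
  have dt: "?t differentiable (at (chart M p q))"
    using smooth_on_differentiable[OF smooth_transition S(2)] .
  have eq: "((\<phi> \<circ> chart_inv M q) \<circ> ?t) y = (\<phi> \<circ> chart_inv M p) y" if "y \<in> ?S" for y
    using that chart_inv_chart by auto
  have d: "((\<phi> \<circ> chart_inv M q) \<circ> ?t) differentiable (at (chart M p q))"
    using differentiable_chain_at[OF dt] \<phi> t by simp
  show "(\<phi> \<circ> chart_inv M p) differentiable (at (chart M p q))"
    by (rule differentiable_cong_open[OF S eq d])
  have "frechet_derivative (\<phi> \<circ> chart_inv M p) (at (chart M p q)) v =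
      frechet_derivative ((\<phi> \<circ> chart_inv M q) \<circ> ?t) (at (chart M p q)) v"
    by (rule fun_cong[OF frechet_derivative_cong_open[OF S eq[symmetric]]])
  also have "\<dots> = fun_diff M \<phi> q (extend_vec M p v q)"
    by (subst frechet_derivative_chain[OF dt]) (use \<phi> t q in \<open>simp_all add: fun_diff_def extend_vec_def\<close>)
  finally show "frechet_derivative (\<phi> \<circ> chart_inv M p) (at (chart M p q)) v = fun_diff M \<phi> q (extend_vec M p v q)" .
qed

lemma frechet_derivative_chart_id:
  assumes "y \<in> chart M p ` chart_dom M p"
  shows "frechet_derivative (chart M p \<circ> chart_inv M p) (at y) v = v"
proof -
  have "frechet_derivative (chart M p \<circ> chart_inv M p) (at y) = frechet_derivative (\<lambda>x. x) (at y)"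
    by (rule frechet_derivative_cong_open[OF open_chart_image assms]) (simp add: chart_chart_inv)
  then show ?thesis by simp
qed

lemma differentiable_chart:
  assumes "q \<in> chart_dom M p"
  shows "(chart M p \<circ> chart_inv M q) differentiable (at (chart M q q))"
  using smooth_on_differentiable[OF smooth_transition[of q p]] assms in_chart_dom by blast

lemma extend_vec_self: "extend_vec M p v p = v"
  using in_chart_dom[of p] by (simp add: extend_vec_def frechet_derivative_chart_id)

lemma linear_extend_vec: "linear (\<lambda>v. extend_vec M p v q)"
proof (cases "q \<in> chart_dom M p")
  case True
  have "(chart M q \<circ> chart_inv M p) differentiable (at (chart M p q))"
    using smooth_on_differentiable[OF smooth_transition] True in_chart_dom by blast
  then show ?thesis using True by (simp add: extend_vec_def linear_frechet_derivative)
next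
  case False then show ?thesis by (simp add: extend_vec_def linear_zero)
qed

lemma components_extend:
  assumes "q \<in> chart_dom M p"
  shows "fun_diff M (chart M p) q (extend_vec M p v q) = v"
  using fun_diff_chart_change(2)[OF assms differentiable_chart[OF assms], of v] assms
  by (simp add: frechet_derivative_chart_id)

lemma extend_components:
  assumes "q \<in> chart_dom M p"
  shows "extend_vec M p (fun_diff M (chart M p) q w) q = w"
proof -
  let ?f = "\<lambda>v. extend_vec M p v q" and ?g = "fun_diff M (chart M p) q"
  have "linear ?g" unfolding fun_diff_def
    by (rule linear_frechet_derivative[OF differentiable_chart[OF assms]])
  moreover have "?g \<circ> ?f = id" using components_extend[OF assms] by auto
  ultimately have "?f \<circ> ?g = id" by (rule linear_inverse_left[OF _ linear_extend_vec, THEN iffD1])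
  then show ?thesis by (metis comp_apply id_apply)
qed

lemma linear_components:
  assumes "q \<in> chart_dom M p"
  shows "linear (fun_diff M (chart M p) q)"
  unfolding fun_diff_def by (rule linear_frechet_derivative[OF differentiable_chart[OF assms]])

lemma components_self: "components M p X p = X p"
  using components_extend[OF in_chart_dom[of p], of "X p"] by (simp add: components_def extend_vec_self)

lemma smooth_field_near_iff:
  "smooth_field_near M p X \<longleftrightarrow> (\<exists>D. open D \<and> chart M p p \<in> D \<and> D \<subseteq> chart M p ` chart_dom M p \<and>
     smooth_on D (components M p X \<circ> chart_inv M p))"
  unfolding smooth_field_near_def smooth_near_iff ..

lemma smooth_field_near_extend: "smooth_field_near M p (extend_vec M p v)"
proof -
  have "smooth_on (chart M p ` chart_dom M p) (components M p (extend_vec M p v) \<circ> chart_inv M p)"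
    by (rule smooth_on_cong[OF open_chart_image _ smooth_on_const[of _ v]])
      (simp add: components_def components_extend chart_inv_in)
  then show ?thesis unfolding smooth_field_near_iff using open_chart_image in_chart_dom by blast
qed

lemma smooth_field_near_diff:
  assumes "smooth_field_near M p X" "smooth_field_near M p Y"
  shows "smooth_field_near M p (\<lambda>q. X q - Y q)"
proof -
  obtain D D' where D: "open D" "chart M p p \<in> D" "D \<subseteq> chart M p ` chart_dom M p"
     "smooth_on D (components M p X \<circ> chart_inv M p)"
    and D': "open D'" "chart M p p \<in> D'" "smooth_on D' (components M p Y \<circ> chart_inv M p)"
    using assms unfolding smooth_field_near_iff by metis
  have "smooth_on (D \<inter> D') (components M p (\<lambda>q. X q - Y q) \<circ> chart_inv M p)"
  proof (rule smooth_on_cong[OF open_Int[OF D(1) D'(1)]])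
    show "smooth_on (D \<inter> D') (\<lambda>y. (components M p X \<circ> chart_inv M p) y - (components M p Y \<circ> chart_inv M p) y)"
      by (intro smooth_on_diff open_Int D D' smooth_on_subset[OF D(4)] smooth_on_subset[OF D'(3)]) auto
    show "(components M p X \<circ> chart_inv M p) y - (components M p Y \<circ> chart_inv M p) y =
        (components M p (\<lambda>q. X q - Y q) \<circ> chart_inv M p) y" if "y \<in> D \<inter> D'" for y
      using linear_diff[OF linear_components[OF chart_inv_in[of y p]]] that D(3)
      by (auto simp: components_def)
  qed
  then show ?thesis unfolding smooth_field_near_iff using D D' by (intro exI[of _ "D \<inter> D'"]) auto
qed

end

lemma metric_scalar_product: "riemannian_manifold M \<Longrightarrow> scalar_product (metric M p)"
  unfolding riemannian_manifold_def scalar_product_def by blast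

lemma metric_in_chart_scalar_product:
  assumes M: "riemannian_manifold M" and q: "q \<in> chart_dom M p"
  shows "scalar_product (\<lambda>v w. metric M q (extend_vec M p v q) (extend_vec M p w q))"
proof -
  have sm: "smooth_manifold M" using M by (simp add: riemannian_manifold_def)
  interpret scalar_product "metric M q" by (rule metric_scalar_product[OF M])
  note lin = linear_extend_vec[OF sm, of p q]
  show ?thesis
  proof
    show "bilinear (\<lambda>v w. metric M q (extend_vec M p v q) (extend_vec M p w q))"
      unfolding bilinear_def
      using linear_compose[OF lin linear_right] linear_compose[OF lin linear_left] by (simp add: o_def)
    show "metric M q (extend_vec M p x q) (extend_vec M p y q) =
        metric M q (extend_vec M p y q) (extend_vec M p x q)" for x y by (rule sym)
    show "metric M q (extend_vec M p x q) (extend_vec M p x q) > 0" if "x \<noteq> 0" for x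
    proof (rule pos, rule notI)
      assume "extend_vec M p x q = 0"
      then have "x = 0"
        using components_extend[OF sm q, of x] linear_0[OF linear_components[OF sm q]] by simp
      with that show False by contradiction
    qed
  qed
qed

text \<open>
  The definition of a Riemannian manifold gives each coefficient of the metric its own neighbourhood;
  by bilinearity the intersection of those for pairs of basis vectors serves all coefficients.
\<close>

lemma metric_in_chart_smooth:
  fixes M :: "('a::{t2_space,second_countable_topology}, 'e::euclidean_space, 'm) riemannian_scheme"
  assumes M: "riemannian_manifold M"
  obtains D where "open D" "chart M p p \<in> D" "D \<subseteq> chart M p ` chart_dom M p"
    "\<And>v w. smooth_on D (\<lambda>y. metric M (chart_inv M p y)
      (extend_vec M p v (chart_inv M p y)) (extend_vec M p w (chart_inv M p y)))"
proof -
  have sm: "smooth_manifold M" using M by (simp add: riemannian_manifold_def)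
  let ?g = "\<lambda>v w y. metric M (chart_inv M p y) (extend_vec M p v (chart_inv M p y)) (extend_vec M p w (chart_inv M p y))"
  let ?P = "Basis \<times> Basis :: ('e \<times> 'e) set"
  define Q where "Q v w D \<longleftrightarrow> open D \<and> chart M p p \<in> D \<and> D \<subseteq> chart M p ` chart_dom M p \<and>
    smooth_on D (?g v w)" for v w D
  have "\<exists>D. Q v w D" for v w
    using M smooth_field_near_extend[OF sm, of p]
    unfolding riemannian_manifold_def smooth_near_iff[OF sm] o_def Q_def by blast
  then obtain D where "\<And>v w. Q v w (D v w)" by metis
  then have D: "open (D v w)" "chart M p p \<in> D v w"
    "D v w \<subseteq> chart M p ` chart_dom M p" "smooth_on (D v w) (?g v w)" for v w
    unfolding Q_def by blast+
  define E where "E = (\<Inter>(v,w)\<in>?P. D v w)"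
  have E: "open E" "chart M p p \<in> E" "\<And>v w. v \<in> Basis \<Longrightarrow> w \<in> Basis \<Longrightarrow> E \<subseteq> D v w"
    unfolding E_def using D by (auto intro!: open_INT)
  obtain b :: 'e where "b \<in> Basis" using nonempty_Basis by blast
  then have sub: "E \<subseteq> chart M p ` chart_dom M p" using E(3) D(3) by blast
  have "smooth_on E (?g v w)" for v w
  proof (rule smooth_on_cong[OF E(1)])
    show "smooth_on E (\<lambda>y. \<Sum>b\<in>Basis. \<Sum>c\<in>Basis. ((v \<bullet> b) * (w \<bullet> c)) * ?g b c y)"
      by (intro smooth_on_sum smooth_on_mult smooth_on_const E(1) smooth_on_subset[OF D(4) E(3)])
    fix y assume "y \<in> E"
    then interpret scalar_product "\<lambda>v w. ?g v w y"
      using metric_in_chart_scalar_product[OF M] chart_inv_in[OF sm] sub by blast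
    show "(\<Sum>b\<in>Basis. \<Sum>c\<in>Basis. ((v \<bullet> b) * (w \<bullet> c)) * ?g b c y) = ?g v w y"
      by (subst linear_eq_sum_Basis[OF linear_left], subst linear_eq_sum_Basis[OF linear_right])
        (simp add: sum_distrib_left mult.assoc)
  qed
  then show thesis using that E sub by blast
qed

section \<open>Riemannian submersions in a chart\<close>

lemma bilinear_eq_sum_Basis:
  fixes v :: "'e::euclidean_space" and w :: "'f::euclidean_space" and K :: "'e \<Rightarrow> 'f \<Rightarrow> real"
  assumes "bilinear K"
  shows "K v w = (\<Sum>i\<in>Basis. \<Sum>j\<in>Basis. (v \<bullet> i) * (w \<bullet> j) * K i j)"
proof -
  have l: "linear (\<lambda>v. K v w)" "\<And>v. linear (K v)" using assms by (auto simp: bilinear_def)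
  have "K v w = (\<Sum>i\<in>Basis. (v \<bullet> i) *\<^sub>R K i w)" by (rule linear_eq_sum_Basis[OF l(1)])
  also have "\<dots> = (\<Sum>i\<in>Basis. \<Sum>j\<in>Basis. (v \<bullet> i) * (w \<bullet> j) * K i j)"
    by (subst linear_eq_sum_Basis[OF l(2)]) (simp add: sum_distrib_left mult.assoc)
  finally show ?thesis .
qed

lemma smooth_on_form:
  fixes a :: "'x::real_normed_vector \<Rightarrow> 'e::euclidean_space" and b :: "'x \<Rightarrow> 'f::euclidean_space"
  assumes S: "open S" and K: "\<And>z. z \<in> S \<Longrightarrow> bilinear (K z)"
    and sK: "\<And>i j. smooth_on S (\<lambda>z. K z i j :: real)" and ab: "smooth_on S a" "smooth_on S b"
  shows "smooth_on S (\<lambda>z. K z (a z) (b z))"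
proof (rule smooth_on_cong[OF S])
  show "smooth_on S (\<lambda>z. \<Sum>i\<in>Basis. \<Sum>j\<in>Basis. (a z \<bullet> i) * (b z \<bullet> j) * K z i j)"
    by (intro smooth_on_sum smooth_on_mult smooth_on_inner smooth_on_const S sK ab)
qed (use bilinear_eq_sum_Basis[OF K] in simp)

lemma has_derivative_form:
  fixes a :: "'x::real_normed_vector \<Rightarrow> 'e::euclidean_space" and b :: "'x \<Rightarrow> 'f::euclidean_space"
  assumes S: "open S" "x \<in> S" and K: "\<And>z. z \<in> S \<Longrightarrow> bilinear (K z)"
    and dK: "\<And>i j. ((\<lambda>z. K z i j :: real) has_derivative K' i j) (at x)"
    and ab: "(a has_derivative a') (at x)" "(b has_derivative b') (at x)"
  shows "((\<lambda>z. K z (a z) (b z)) has_derivative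
    (\<lambda>u. (\<Sum>i\<in>Basis. \<Sum>j\<in>Basis. (a x \<bullet> i) * (b x \<bullet> j) * K' i j u) + K x (a' u) (b x) + K x (a x) (b' u))) (at x)"
proof -
  let ?L = "\<lambda>u. \<Sum>i\<in>Basis. \<Sum>j\<in>Basis. (a x \<bullet> i) * (b x \<bullet> j) * K' i j u +
     ((a x \<bullet> i) * (b' u \<bullet> j) + (a' u \<bullet> i) * (b x \<bullet> j)) * K x i j"
  have "((\<lambda>z. \<Sum>i\<in>Basis. \<Sum>j\<in>Basis. (a z \<bullet> i) * (b z \<bullet> j) * K z i j) has_derivative ?L) (at x)"
    by (intro has_derivative_sum has_derivative_mult has_derivative_inner_left ab dK)
  then have "((\<lambda>z. K z (a z) (b z)) has_derivative ?L) (at x)"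
    by (rule has_derivative_transform_within_open[OF _ S]) (rule bilinear_eq_sum_Basis[OF K, symmetric])
  moreover have "?L u = (\<Sum>i\<in>Basis. \<Sum>j\<in>Basis. (a x \<bullet> i) * (b x \<bullet> j) * K' i j u) + K x (a' u) (b x) + K x (a x) (b' u)" for u
    unfolding bilinear_eq_sum_Basis[OF K[OF S(2)], of "a' u" "b x"]
      bilinear_eq_sum_Basis[OF K[OF S(2)], of "a x" "b' u"]
    by (simp add: sum.distrib algebra_simps)
  ultimately show ?thesis by simp
qed

text \<open>
  The fields on which O'Neill's tensor at \<open>p\<close> is evaluated.
\<close>

definition hfield ::
  "('a, 'e::real_normed_vector, 'm) riemannian_scheme \<Rightarrow> ('b, 'f::real_normed_vector, 'n) manifold_scheme \<Rightarrow>
   ('a \<Rightarrow> 'b) \<Rightarrow> 'a \<Rightarrow> 'e \<Rightarrow> 'a \<Rightarrow> 'e" where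
  "hfield M N F p x q = hproj M N F q (extend_vec M p x q)"

definition vfield ::
  "('a, 'e::real_normed_vector, 'm) riemannian_scheme \<Rightarrow> ('b, 'f::real_normed_vector, 'n) manifold_scheme \<Rightarrow>
   ('a \<Rightarrow> 'b) \<Rightarrow> 'a \<Rightarrow> 'e \<Rightarrow> 'a \<Rightarrow> 'e" where
  "vfield M N F p x q = vproj M N F q (extend_vec M p x q)"

context
  fixes M :: "('a::{t2_space,second_countable_topology}, 'e::euclidean_space, 'm) riemannian_scheme"
    and N :: "('b::{t2_space,second_countable_topology}, 'f::euclidean_space, 'n) riemannian_scheme"
    and F :: "'a \<Rightarrow> 'b"
  assumes sub: "riemannian_submersion M N F"
begin

lemma dom_riemannian: "riemannian_manifold M" and cod_riemannian: "riemannian_manifold N"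
  and smooth_submersion: "smooth_map M N F"
  using sub by (auto simp: riemannian_submersion_def)

lemma dom_smooth: "smooth_manifold M" and cod_smooth: "smooth_manifold N"
  using dom_riemannian cod_riemannian by (auto simp: riemannian_manifold_def)

lemma map_differentiable:
  "(chart N (F p) \<circ> F \<circ> chart_inv M p) differentiable (at (chart M p p))"
  using smooth_submersion smooth_on_differentiable unfolding smooth_map_def by blast

lemma linear_map_diff: "linear (map_diff M N F p)"
  unfolding map_diff_def fun_diff_def by (rule linear_frechet_derivative[OF map_differentiable])

lemma subspace_vertical: "subspace (vertical M N F p)"
  unfolding vertical_def using linear_map_diff[of p]
  by (auto simp: subspace_def linear_0 linear_add linear_cmul)

lemma subspace_horizontal: "subspace (horizontal M N F p)"
proof -
  interpret scalar_product "metric M p" by (rule metric_scalar_product[OF dom_riemannian])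
  show ?thesis unfolding horizontal_def by (auto simp: subspace_def form_simps)
qed

lemma horizontal_vertical:
  "x \<in> horizontal M N F p \<Longrightarrow> u \<in> vertical M N F p \<Longrightarrow> metric M p x u = 0"
  "x \<in> horizontal M N F p \<Longrightarrow> u \<in> vertical M N F p \<Longrightarrow> metric M p u x = 0"
  using scalar_product.sym[OF metric_scalar_product[OF dom_riemannian]] by (auto simp: horizontal_def)

lemma vproj_in: "vproj M N F p v \<in> vertical M N F p"
  and hproj_in: "hproj M N F p v \<in> horizontal M N F p"
  and hproj_form: "x \<in> horizontal M N F p \<Longrightarrow> metric M p (hproj M N F p v) x = metric M p v x"
  and vproj_form: "u \<in> vertical M N F p \<Longrightarrow> metric M p (vproj M N F p v) u = metric M p v u"
  and hproj_id: "x \<in> horizontal M N F p \<Longrightarrow> hproj M N F p x = x"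
  and vproj_id: "u \<in> vertical M N F p \<Longrightarrow> vproj M N F p u = u"
  and linear_hproj: "linear (hproj M N F p)"
  and linear_vproj: "linear (vproj M N F p)"
  unfolding vproj_def hproj_def
  by (simp_all add: scalar_product.orth_proj scalar_product.orth_proj_form scalar_product.orth_proj_id
      scalar_product.linear_orth_proj metric_scalar_product[OF dom_riemannian] subspace_vertical subspace_horizontal)

lemma hproj_plus_vproj: "hproj M N F p v = v - vproj M N F p v"
proof -
  interpret scalar_product "metric M p" by (rule metric_scalar_product[OF dom_riemannian])
  have "v - vproj M N F p v \<in> horizontal M N F p"
    unfolding horizontal_def using vproj_form by (simp add: diff_left)
  then show ?thesis
    unfolding hproj_def
    by (intro orth_proj_eqI subspace_horizontal) (simp_all add: horizontal_vertical vproj_in)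
qed

lemma vproj_horizontal: "x \<in> horizontal M N F p \<Longrightarrow> vproj M N F p x = 0"
  using hproj_plus_vproj[of p x] hproj_id by simp

lemma map_diff_hproj: "map_diff M N F p (hproj M N F p v) = map_diff M N F p v"
  using vproj_in[of p v] by (simp add: hproj_plus_vproj linear_diff[OF linear_map_diff] vertical_def)

lemma hproj_metric_pullback:
  "metric M p (hproj M N F p v) (hproj M N F p w) =
    metric N (F p) (map_diff M N F p v) (map_diff M N F p w)"
proof -
  have "metric N (F p) (map_diff M N F p (hproj M N F p v)) (map_diff M N F p (hproj M N F p w)) =
      metric M p (hproj M N F p v) (hproj M N F p w)"
    using sub hproj_in unfolding riemannian_submersion_def by blast
  then show ?thesis by (simp add: map_diff_hproj)
qed

text \<open>
  The metric of the base, pulled back along \<open>F\<close>, in the chart at \<open>p\<close>: \<open>f\<close> is the local expression of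
  \<open>F\<close>, and \<open>K z\<close> is the metric of the base at the image point, written in the chart at \<open>F p\<close>. As \<open>K z\<close>
  depends on \<open>z\<close> only through \<open>f z\<close>, it is stationary in the directions in which \<open>f\<close> is.
\<close>

lemma submersion_in_chart:
  fixes p :: 'a
  defines "f \<equiv> chart N (F p) \<circ> F \<circ> chart_inv M p"
  obtains D K where "open D" "chart M p p \<in> D" "D \<subseteq> chart M p ` chart_dom M p" "smooth_on D f"
    "\<And>v w. smooth_on D (\<lambda>y. metric M (chart_inv M p y)
      (extend_vec M p v (chart_inv M p y)) (extend_vec M p w (chart_inv M p y)))"
    "\<And>z. z \<in> D \<Longrightarrow> bilinear (K z)" "\<And>a b. smooth_on D (\<lambda>z. K z a b :: real)"
    "\<And>a b u. frechet_derivative f (at (chart M p p)) u = 0 \<Longrightarrow>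
       frechet_derivative (\<lambda>z. K z a b) (at (chart M p p)) u = 0"
    "\<And>z v w. z \<in> D \<Longrightarrow> metric M (chart_inv M p z) (hproj M N F (chart_inv M p z) (extend_vec M p v (chart_inv M p z)))
         (hproj M N F (chart_inv M p z) (extend_vec M p w (chart_inv M p z))) =
       K z (frechet_derivative f (at z) v) (frechet_derivative f (at z) w)"
    "\<And>z v. z \<in> D \<Longrightarrow> map_diff M N F (chart_inv M p z) (extend_vec M p v (chart_inv M p z)) = 0 \<longleftrightarrow>
       frechet_derivative f (at z) v = 0"
proof -
  let ?y = "chart M p p" and ?n = "F p"
  obtain U where U: "open U" "p \<in> U" "U \<subseteq> chart_dom M p" "F ` U \<subseteq> chart_dom N ?n" "smooth_on (chart M p ` U) f"
    using smooth_submersion unfolding smooth_map_def f_def by blast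
  obtain D1 where D1: "open D1" "?y \<in> D1" "D1 \<subseteq> chart M p ` chart_dom M p"
    "\<And>v w. smooth_on D1 (\<lambda>y. metric M (chart_inv M p y)
      (extend_vec M p v (chart_inv M p y)) (extend_vec M p w (chart_inv M p y)))"
    by (rule metric_in_chart_smooth[OF dom_riemannian, of p]) blast
  obtain E where E: "open E" "chart N ?n ?n \<in> E" "E \<subseteq> chart N ?n ` chart_dom N ?n"
    "\<And>v w. smooth_on E (\<lambda>y. metric N (chart_inv N ?n y)
      (extend_vec N ?n v (chart_inv N ?n y)) (extend_vec N ?n w (chart_inv N ?n y)))"
    by (rule metric_in_chart_smooth[OF cod_riemannian, of ?n]) blast
  have oU: "open (chart M p ` U)" using open_chart_image_subset[OF dom_smooth U(1,3)] .
  define D where "D = D1 \<inter> (f -` E \<inter> chart M p ` U)"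
  have fy: "f ?y = chart N ?n ?n" by (simp add: f_def chart_inv_chart[OF dom_smooth in_chart_dom[OF dom_smooth]])
  have "open (f -` E \<inter> chart M p ` U)"
    using continuous_on_open_vimage[OF oU] smooth_on_continuous[OF U(5)] E(1) by blast
  then have oD: "open D" using D1 by (auto simp: D_def)
  have yD: "?y \<in> D" using D1 U(2) E(2) fy by (auto simp: D_def)
  have DU: "D \<subseteq> chart M p ` U" and Dd: "D \<subseteq> chart M p ` chart_dom M p" and fE: "f ` D \<subseteq> E"
    using U by (auto simp: D_def)
  have sf: "smooth_on D f" using smooth_on_subset[OF U(5) DU] .
  have inU: "chart_inv M p z \<in> U" if "z \<in> D" for z
  proof -
    from that DU obtain u where "u \<in> U" "z = chart M p u" by blast
    with U(3) show ?thesis using chart_inv_chart[OF dom_smooth, of u p] by auto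
  qed
  then have Fin: "F (chart_inv M p z) \<in> chart_dom N ?n" if "z \<in> D" for z using that U(4) by blast
  define k where "k = (\<lambda>z a b. metric N (chart_inv N ?n z) (extend_vec N ?n a (chart_inv N ?n z)) (extend_vec N ?n b (chart_inv N ?n z)))"
  have inv_f: "chart_inv N ?n (f z) = F (chart_inv M p z)" if "z \<in> D" for z
    using chart_inv_chart[OF cod_smooth Fin[OF that]] by (simp add: f_def)
  have push: "map_diff M N F (chart_inv M p z) (extend_vec M p v (chart_inv M p z)) =
      extend_vec N ?n (frechet_derivative f (at z) v) (F (chart_inv M p z))" if z: "z \<in> D" for z v
  proof -
    let ?q = "chart_inv M p z"
    let ?\<phi> = "chart N (F ?q) \<circ> F" and ?t = "chart N (F ?q) \<circ> chart_inv N ?n"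
    have q: "?q \<in> chart_dom M p" "chart M p ?q = z"
      using z Dd chart_inv_in[OF dom_smooth] chart_chart_inv[OF dom_smooth] by auto
    have "map_diff M N F ?q (extend_vec M p v ?q) = frechet_derivative (?\<phi> \<circ> chart_inv M p) (at z) v"
      unfolding map_diff_def using fun_diff_chart_change(2)[OF dom_smooth q(1) map_differentiable] q(2) by simp
    also have "\<dots> = frechet_derivative (?t \<circ> f) (at z) v"
      by (rule fun_cong[OF frechet_derivative_cong_open[OF oD z]]) (simp add: inv_f)
    also have "\<dots> = extend_vec N ?n (frechet_derivative f (at z) v) (F ?q)"
    proof (subst frechet_derivative_chain)
      show "f differentiable at z" by (rule smooth_on_differentiable[OF sf z])
      have "f z = chart N ?n (F ?q)" by (simp add: f_def)
      then show "?t differentiable at (f z)"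
        using smooth_on_differentiable[OF smooth_transition[OF cod_smooth, of ?n "F ?q"]] Fin[OF z] in_chart_dom[OF cod_smooth]
        by auto
      show "frechet_derivative ?t (at (f z)) (frechet_derivative f (at z) v) =
          extend_vec N ?n (frechet_derivative f (at z) v) (F ?q)"
        using Fin[OF z] by (simp add: extend_vec_def f_def)
    qed
    finally show ?thesis .
  qed
  show thesis
  proof
    show "open D" "?y \<in> D" "D \<subseteq> chart M p ` chart_dom M p" "smooth_on D f" by fact+
    show "smooth_on D (\<lambda>y. metric M (chart_inv M p y)
      (extend_vec M p v (chart_inv M p y)) (extend_vec M p w (chart_inv M p y)))" for v w
      by (rule smooth_on_subset[OF D1(4)]) (auto simp: D_def)
    show "bilinear (k (f z))" if "z \<in> D" for z
      unfolding k_def using scalar_product.bilin[OF metric_in_chart_scalar_product[OF cod_riemannian Fin[OF that]]]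
      by (simp add: inv_f[OF that])
    show "smooth_on D (\<lambda>z. k (f z) a b)" for a b
      using smooth_on_compose[OF oD E(1) fE sf E(4)] unfolding k_def .
    show "frechet_derivative (\<lambda>z. k (f z) a b) (at ?y) u = 0" if "frechet_derivative f (at ?y) u = 0" for a b u
    proof -
      have d: "(\<lambda>z. k z a b) differentiable (at (f ?y))"
        unfolding k_def using smooth_on_differentiable[OF E(4)] E(2) fy by simp
      have "frechet_derivative ((\<lambda>z. k z a b) \<circ> f) (at ?y) u = 0"
        by (subst frechet_derivative_chain[OF smooth_on_differentiable[OF sf yD] d])
          (simp add: that linear_0[OF linear_frechet_derivative[OF d]])
      then show ?thesis by (simp add: o_def)
    qed
    show "metric M (chart_inv M p z) (hproj M N F (chart_inv M p z) (extend_vec M p v (chart_inv M p z)))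
         (hproj M N F (chart_inv M p z) (extend_vec M p w (chart_inv M p z))) =
       k (f z) (frechet_derivative f (at z) v) (frechet_derivative f (at z) w)" if "z \<in> D" for z v w
      unfolding hproj_metric_pullback push[OF that] k_def inv_f[OF that] ..
    show "map_diff M N F (chart_inv M p z) (extend_vec M p v (chart_inv M p z)) = 0 \<longleftrightarrow>
       frechet_derivative f (at z) v = 0" if "z \<in> D" for z v
      unfolding push[OF that]
      using components_extend[OF cod_smooth Fin[OF that], of "frechet_derivative f (at z) v"]
        linear_0[OF linear_components[OF cod_smooth Fin[OF that]]] linear_0[OF linear_extend_vec[OF cod_smooth]] by auto
  qed
qed

text \<open>
  With respect to \<open>g\<^sub>1\<close>, the horizontal part of \<open>E\<close> represents the functional
  \<open>w \<mapsto> g\<^sub>2(F\<^sub>*E, F\<^sub>*w)\<close>: the vertical part of \<open>w\<close> contributes to neither \<open>g\<^sub>1(\<H>E, w)\<close> nor \<open>F\<^sub>*w\<close>.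
  So it is smooth because the pulled-back metric is.
\<close>

lemma smooth_hfield: "smooth_field_near M p (hfield M N F p x)"
proof -
  let ?f = "chart N (F p) \<circ> F \<circ> chart_inv M p" and ?i = "chart_inv M p"
  let ?G = "\<lambda>y v w. metric M (?i y) (extend_vec M p v (?i y)) (extend_vec M p w (?i y))"
  obtain D K where D: "open D" "chart M p p \<in> D" "D \<subseteq> chart M p ` chart_dom M p" "smooth_on D ?f"
    and sG: "\<And>v w. smooth_on D (\<lambda>y. ?G y v w)"
    and K: "\<And>z. z \<in> D \<Longrightarrow> bilinear (K z)" "\<And>a b. smooth_on D (\<lambda>z. K z a b :: real)"
      "\<And>z v w. z \<in> D \<Longrightarrow> metric M (?i z) (hproj M N F (?i z) (extend_vec M p v (?i z)))
         (hproj M N F (?i z) (extend_vec M p w (?i z))) =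
         K z (frechet_derivative ?f (at z) v) (frechet_derivative ?f (at z) w)"
    by (rule submersion_in_chart[of p]) blast
  have "smooth_on D (components M p (hfield M N F p x) \<circ> ?i)"
  proof (rule smooth_riesz[OF D(1), where G = ?G])
    show "scalar_product (?G y)" if "y \<in> D" for y
      using metric_in_chart_scalar_product[OF dom_riemannian chart_inv_in[OF dom_smooth]] that D(3) by blast
    show "smooth_on D (\<lambda>y. ?G y b b')" for b b' by (rule sG)
    show "smooth_on D (\<lambda>y. ?G y ((components M p (hfield M N F p x) \<circ> ?i) y) b)" for b
    proof (rule smooth_on_cong[OF D(1)])
      show "smooth_on D (\<lambda>z. K z (frechet_derivative ?f (at z) x) (frechet_derivative ?f (at z) b))"
        by (rule smooth_on_form[OF D(1) K(1,2) smooth_on_derivative[OF D(4)] smooth_on_derivative[OF D(4)]])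
      show "K z (frechet_derivative ?f (at z) x) (frechet_derivative ?f (at z) b) =
          ?G z ((components M p (hfield M N F p x) \<circ> ?i) z) b" if "z \<in> D" for z
      proof -
        have q: "?i z \<in> chart_dom M p" using that D(3) chart_inv_in[OF dom_smooth] by blast
        have "metric M (?i z) (hfield M N F p x (?i z)) (extend_vec M p b (?i z)) =
          metric M (?i z) (hfield M N F p x (?i z)) (hproj M N F (?i z) (extend_vec M p b (?i z)))"
          using hproj_form[OF hproj_in, of "?i z" "extend_vec M p b (?i z)"]
            scalar_product.sym[OF metric_scalar_product[OF dom_riemannian]] unfolding hfield_def by metis
        then show ?thesis
          unfolding K(3)[OF that, symmetric] by (simp add: components_def extend_components[OF dom_smooth q] hfield_def)
      qed
    qed
  qed
  then show ?thesis unfolding smooth_field_near_iff[OF dom_smooth] using D by blast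
qed

lemma vfield_eq: "vfield M N F p x = (\<lambda>q. extend_vec M p x q - hfield M N F p x q)"
  by (auto simp: vfield_def hfield_def hproj_plus_vproj)

lemma smooth_vfield: "smooth_field_near M p (vfield M N F p x)"
  unfolding vfield_eq
  by (intro smooth_field_near_diff[OF dom_smooth] smooth_hfield smooth_field_near_extend[OF dom_smooth])

lemma hfield_in: "hfield M N F p x q \<in> horizontal M N F q"
  and vfield_in: "vfield M N F p x q \<in> vertical M N F q"
  by (auto simp: hfield_def vfield_def hproj_in vproj_in)

lemma hfield_self: "x \<in> horizontal M N F p \<Longrightarrow> hfield M N F p x p = x"
  and vfield_self: "u \<in> vertical M N F p \<Longrightarrow> vfield M N F p u p = u"
  by (simp_all add: hfield_def vfield_def extend_vec_self[OF dom_smooth] hproj_id vproj_id)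

lemma hfield_add: "hfield M N F p (x + y) = (\<lambda>q. hfield M N F p x q + hfield M N F p y q)"
  and hfield_scale: "hfield M N F p (c *\<^sub>R x) = (\<lambda>q. c *\<^sub>R hfield M N F p x q)"
  and vfield_add: "vfield M N F p (x + y) = (\<lambda>q. vfield M N F p x q + vfield M N F p y q)"
  and vfield_scale: "vfield M N F p (c *\<^sub>R x) = (\<lambda>q. c *\<^sub>R vfield M N F p x q)"
  by (auto simp: hfield_def vfield_def linear_add[OF linear_extend_vec[OF dom_smooth]] linear_cmul[OF linear_extend_vec[OF dom_smooth]]
      linear_add[OF linear_hproj] linear_cmul[OF linear_hproj] linear_add[OF linear_vproj] linear_cmul[OF linear_vproj])

lemma field_differentiable:
  "smooth_field_near M p X \<Longrightarrow> (components M p X \<circ> chart_inv M p) differentiable (at (chart M p p))"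
  unfolding smooth_field_near_def using smooth_near_differentiable[OF dom_smooth] .

text \<open>
  On horizontal vectors the metric is the pullback of the metric of the base, and the Lie derivative of
  that pullback along a vertical field is zero. In the chart at \<open>p\<close>, let \<open>f\<close> be the local expression
  of \<open>F\<close>. The metric coefficients of the base are stationary along \<open>u\<close>, the images \<open>F\<^sub>*X\<close> and \<open>F\<^sub>*Y\<close> vary
  along \<open>u\<close> by \<open>D\<^sup>2f(u,x)\<close> and \<open>D\<^sup>2f(u,y)\<close>, and these vectors are also the images of \<open>[U,X]\<close> and \<open>[U,Y]\<close>.
\<close>

lemma vertical_lie_derivative:
  assumes x: "x \<in> horizontal M N F p" and y: "y \<in> horizontal M N F p" and u: "u \<in> vertical M N F p"
  defines "X \<equiv> hfield M N F p x" and "Y \<equiv> hfield M N F p y" and "U \<equiv> vfield M N F p u"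
  shows "fun_diff M (\<lambda>q. metric M q (X q) (Y q)) p u =
    metric M p (lie_bracket M U X p) y + metric M p x (lie_bracket M U Y p)"
proof -
  define f where "f = chart N (F p) \<circ> F \<circ> chart_inv M p"
  let ?y = "chart M p p" and ?i = "chart_inv M p"
  let ?D = "\<lambda>z. frechet_derivative f (at z)"
  have iy: "?i ?y = p" using chart_inv_chart[OF dom_smooth in_chart_dom[OF dom_smooth]] .
  obtain D K where D: "open D" "?y \<in> D" "D \<subseteq> chart M p ` chart_dom M p" "smooth_on D f"
    and K: "\<And>z. z \<in> D \<Longrightarrow> bilinear (K z)" "\<And>a b. smooth_on D (\<lambda>z. K z a b :: real)"
      "\<And>a b u. ?D ?y u = 0 \<Longrightarrow> frechet_derivative (\<lambda>z. K z a b) (at ?y) u = 0"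
      "\<And>z v w. z \<in> D \<Longrightarrow> metric M (?i z) (hproj M N F (?i z) (extend_vec M p v (?i z)))
         (hproj M N F (?i z) (extend_vec M p w (?i z))) = K z (?D z v) (?D z w)"
      "\<And>z v. z \<in> D \<Longrightarrow> map_diff M N F (?i z) (extend_vec M p v (?i z)) = 0 \<longleftrightarrow> ?D z v = 0"
    unfolding f_def by (rule submersion_in_chart[of p]) blast
  have linD: "linear (?D z)" if "z \<in> D" for z
    using linear_frechet_derivative[OF smooth_on_differentiable[OF D(4) that]] .
  have ext_p: "extend_vec M p v p = v" for v by (rule extend_vec_self[OF dom_smooth])
  have Du: "?D ?y u = 0"
    using K(5)[OF D(2), of u] u unfolding iy ext_p by (simp add: vertical_def)
  have comp: "(components M p Z \<circ> ?i has_derivative frechet_derivative (components M p Z \<circ> ?i) (at ?y)) (at ?y)"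
    if "smooth_field_near M p Z" for Z
    using field_differentiable[OF that] frechet_derivative_works by blast
  \<comment> \<open>A vertical field stays in the kernel of \<open>?D\<close>, so differentiating the identity
    \<open>?D z (W z) = 0\<close> relates its derivative to the Hessian of \<open>f\<close>.\<close>
  have vert: "?D ?y (frechet_derivative (components M p (vfield M N F p w) \<circ> ?i) (at ?y) v) =
      - frechet_derivative (\<lambda>z. ?D z (vproj M N F p w)) (at ?y) v" for v w
  proof -
    let ?W = "components M p (vfield M N F p w) \<circ> ?i"
    have W0: "?W ?y = vproj M N F p w"
      by (simp add: iy components_self[OF dom_smooth] vfield_def ext_p)
    have "?D z (?W z) = 0" if "z \<in> D" for z
    proof -
      have q: "?i z \<in> chart_dom M p" using that D(3) chart_inv_in[OF dom_smooth] by blast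
      show ?thesis
        using K(5)[OF that, of "?W z"] vfield_in[of p w "?i z"]
        by (simp add: components_def extend_components[OF dom_smooth q] vertical_def)
    qed
    then have "frechet_derivative (\<lambda>z. ?D z (?W z)) (at ?y) = frechet_derivative (\<lambda>z. 0) (at ?y)"
      by (intro frechet_derivative_cong_open[OF D(1,2)])
    moreover have "frechet_derivative (\<lambda>z. ?D z (?W z)) (at ?y) v =
       frechet_derivative (\<lambda>z. ?D z (?W ?y)) (at ?y) v + ?D ?y (frechet_derivative ?W (at ?y) v)"
      by (rule fun_cong[OF frechet_derivative_at[symmetric,
              OF has_derivative_derivative_along[OF D(1,2,4) comp[OF smooth_vfield]]]])
    ultimately show ?thesis unfolding W0 by (simp add: eq_neg_iff_add_eq_0 add.commute)
  qed
  have bracket: "?D ?y (lie_bracket M U (hfield M N F p w) p) =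
      frechet_derivative (\<lambda>z. ?D z w) (at ?y) u" if w: "w \<in> horizontal M N F p" for w
  proof -
    let ?W = "components M p (vfield M N F p w) \<circ> ?i" and ?H = "components M p (hfield M N F p w) \<circ> ?i"
    have "?H z = w - ?W z" if "z \<in> D" for z
    proof -
      have q: "?i z \<in> chart_dom M p" using that D(3) chart_inv_in[OF dom_smooth] by blast
      have "fun_diff M (chart M p) (?i z) (extend_vec M p w (?i z)) = w" by (rule components_extend[OF dom_smooth q])
      then show ?thesis
        by (simp add: components_def vfield_eq linear_diff[OF linear_components[OF dom_smooth q]])
    qed
    then have "frechet_derivative ?H (at ?y) = frechet_derivative (\<lambda>z. w - ?W z) (at ?y)"
      by (intro frechet_derivative_cong_open[OF D(1,2)])
    also have "\<dots> = (\<lambda>v. 0 - frechet_derivative ?W (at ?y) v)"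
      by (rule frechet_derivative_at[symmetric, OF has_derivative_diff[OF has_derivative_const comp[OF smooth_vfield]]])
    finally have H: "?D ?y (frechet_derivative ?H (at ?y) u) = frechet_derivative (\<lambda>z. ?D z (vproj M N F p w)) (at ?y) u"
      using vert[of w u] by (simp add: linear_neg[OF linD[OF D(2)]])
    have "frechet_derivative (\<lambda>z. ?D z 0) (at ?y) = frechet_derivative (\<lambda>z. 0) (at ?y)"
      by (rule frechet_derivative_cong_open[OF D(1,2)]) (simp add: linear_0[OF linD])
    with H have H: "?D ?y (frechet_derivative ?H (at ?y) u) = 0"
      by (simp add: vproj_horizontal[OF w])
    have "?D ?y (lie_bracket M U (hfield M N F p w) p) =
        - ?D ?y (frechet_derivative (components M p U \<circ> ?i) (at ?y) w)"
      using H by (simp add: lie_bracket_def fun_diff_def linear_diff[OF linD[OF D(2)]] U_def vfield_self[OF u] hfield_self[OF w])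
    also have "\<dots> = frechet_derivative (\<lambda>z. ?D z u) (at ?y) w"
      unfolding U_def vert by (simp add: vproj_id[OF u])
    also have "\<dots> = frechet_derivative (\<lambda>z. ?D z w) (at ?y) u"
      by (rule second_derivative_symmetric[OF D(1,2,4)])
    finally show ?thesis .
  qed
  have Kp: "metric M p v w = K ?y (?D ?y v) (?D ?y w)" "metric M p w v = K ?y (?D ?y w) (?D ?y v)"
    if "w \<in> horizontal M N F p" for v w
    using K(4)[OF D(2), of v w] K(4)[OF D(2), of w v] hproj_form[OF that, of v]
      scalar_product.sym[OF metric_scalar_product[OF dom_riemannian], of p w]
    by (simp_all add: iy ext_p hproj_id[OF that])
  have dD: "((\<lambda>z. ?D z w) has_derivative frechet_derivative (\<lambda>z. ?D z w) (at ?y)) (at ?y)" for w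
    using smooth_on_differentiable[OF smooth_on_derivative[OF D(4)] D(2)] frechet_derivative_works by blast
  have dK: "((\<lambda>z. K z i j) has_derivative frechet_derivative (\<lambda>z. K z i j) (at ?y)) (at ?y)" for i j
    using smooth_on_differentiable[OF K(2) D(2)] frechet_derivative_works by blast
  have "fun_diff M (\<lambda>q. metric M q (X q) (Y q)) p u =
      frechet_derivative (\<lambda>z. K z (?D z x) (?D z y)) (at ?y) u"
    unfolding fun_diff_def
    by (rule fun_cong[OF frechet_derivative_cong_open[OF D(1,2)]]) (simp add: X_def Y_def hfield_def K(4))
  also have "\<dots> = K ?y (frechet_derivative (\<lambda>z. ?D z x) (at ?y) u) (?D ?y y) +
      K ?y (?D ?y x) (frechet_derivative (\<lambda>z. ?D z y) (at ?y) u)"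
    by (subst frechet_derivative_at[symmetric, OF has_derivative_form[OF D(1,2) K(1) dK dD dD]])
      (simp_all add: K(3)[OF Du])
  also have "\<dots> = metric M p (lie_bracket M U X p) y + metric M p x (lie_bracket M U Y p)"
    unfolding Kp(1)[OF y] Kp(2)[OF x] X_def Y_def bracket[OF x] bracket[OF y] ..
  finally show ?thesis .
qed

end

section \<open>O'Neill's tensor and the horizontal curvature\<close>

context
  fixes M :: "('a::{t2_space,second_countable_topology}, 'e::euclidean_space, 'm) riemannian_scheme"
    and nabla :: "('a \<Rightarrow> 'e) \<Rightarrow> ('a \<Rightarrow> 'e) \<Rightarrow> 'a \<Rightarrow> 'e"
  assumes M: "riemannian_manifold M" and LC: "levi_civita M nabla"
begin

lemma nabla_metric:
  assumes "smooth_field_near M p X" "smooth_field_near M p Y" "smooth_field_near M p Z"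
  shows "fun_diff M (\<lambda>q. metric M q (Y q) (Z q)) p (X p) =
    metric M p (nabla X Y p) (Z p) + metric M p (Y p) (nabla X Z p)"
  using LC assms smooth_near_const[of M p "0::real"] M
  unfolding levi_civita_def riemannian_manifold_def by blast

lemma nabla_torsion_free:
  assumes "smooth_field_near M p X" "smooth_field_near M p Y"
  shows "nabla X Y p - nabla Y X p = lie_bracket M X Y p"
  using LC assms smooth_near_const[of M p "0::real"] M
  unfolding levi_civita_def riemannian_manifold_def by blast

lemma nabla_add:
  assumes "smooth_field_near M p X" "smooth_field_near M p Y" "smooth_field_near M p Z"
  shows "nabla (\<lambda>q. X q + Y q) Z p = nabla X Z p + nabla Y Z p"
    and "nabla Z (\<lambda>q. X q + Y q) p = nabla Z X p + nabla Z Y p"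
  using LC assms smooth_near_const[of M p "0::real"] M
  unfolding levi_civita_def riemannian_manifold_def by blast+

lemma nabla_scale:
  fixes c :: real
  assumes "smooth_field_near M p X" "smooth_field_near M p Y"
  shows "nabla (\<lambda>q. c *\<^sub>R X q) Y p = c *\<^sub>R nabla X Y p"
    and "nabla X (\<lambda>q. c *\<^sub>R Y q) p = c *\<^sub>R nabla X Y p"
proof -
  have sM: "smooth_manifold M" using M by (simp add: riemannian_manifold_def)
  have sc: "smooth_near M p (\<lambda>q. c)" by (rule smooth_near_const[OF sM])
  show "nabla (\<lambda>q. c *\<^sub>R X q) Y p = c *\<^sub>R nabla X Y p"
    using LC[unfolded levi_civita_def, rule_format, OF assms(1,2,2) sc] by blast
  show "nabla X (\<lambda>q. c *\<^sub>R Y q) p = c *\<^sub>R nabla X Y p"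
    using LC[unfolded levi_civita_def, rule_format, OF assms(1,2,2) sc]
    by (simp add: fun_diff_const[OF sM])
qed

end

context
  fixes M :: "('a::{t2_space,second_countable_topology}, 'e::euclidean_space, 'm) riemannian_scheme"
    and N :: "('b::{t2_space,second_countable_topology}, 'f::euclidean_space, 'n) riemannian_scheme"
    and F :: "'a \<Rightarrow> 'b"
    and nabla :: "('a \<Rightarrow> 'e) \<Rightarrow> ('a \<Rightarrow> 'e) \<Rightarrow> 'a \<Rightarrow> 'e"
  assumes sub: "riemannian_submersion M N F" and LC: "levi_civita M nabla"
begin

lemma oneill_A_at_eq:
  "oneill_A_at M N F nabla p x y =
    vproj M N F p (nabla (hfield M N F p x) (hfield M N F p y) p) +
    hproj M N F p (nabla (hfield M N F p x) (vfield M N F p y) p)"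
  unfolding oneill_A_at_def oneill_A_def hfield_def[abs_def] vfield_def[abs_def] ..

text \<open>
  Extension and projection are linear at each point, and \<open>nabla\<close> is additive and homogeneous for
  constant factors in both arguments.
\<close>

lemma linear_oneill_A:
  "linear (oneill_A_at M N F nabla p x)" "linear (\<lambda>x. oneill_A_at M N F nabla p x y)"
proof -
  note * = smooth_hfield[OF sub] smooth_vfield[OF sub]
  show "linear (oneill_A_at M N F nabla p x)"
    by (rule linearI)
      (simp_all add: oneill_A_at_eq hfield_add[OF sub] hfield_scale[OF sub] vfield_add[OF sub] vfield_scale[OF sub]
        nabla_add[OF dom_riemannian[OF sub] LC] nabla_scale[OF dom_riemannian[OF sub] LC] *
        linear_add[OF linear_hproj[OF sub]] linear_cmul[OF linear_hproj[OF sub]]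
        linear_add[OF linear_vproj[OF sub]] linear_cmul[OF linear_vproj[OF sub]] algebra_simps)
  show "linear (\<lambda>x. oneill_A_at M N F nabla p x y)"
    by (rule linearI)
      (simp_all add: oneill_A_at_eq hfield_add[OF sub] hfield_scale[OF sub] vfield_add[OF sub] vfield_scale[OF sub]
        nabla_add[OF dom_riemannian[OF sub] LC] nabla_scale[OF dom_riemannian[OF sub] LC] *
        linear_add[OF linear_hproj[OF sub]] linear_cmul[OF linear_hproj[OF sub]]
        linear_add[OF linear_vproj[OF sub]] linear_cmul[OF linear_vproj[OF sub]] algebra_simps)
qed

lemma nabla_orthogonal:
  assumes "smooth_field_near M p X" "smooth_field_near M p Y" "smooth_field_near M p Z"
    and "\<And>q. metric M q (Y q) (Z q) = 0"
  shows "metric M p (nabla X Y p) (Z p) = - metric M p (Y p) (nabla X Z p)"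
  using nabla_metric[OF dom_riemannian[OF sub] LC assms(1-3)] fun_diff_const[OF dom_smooth[OF sub], of "0::real"] by (simp add: assms(4))

text \<open>
  Against a horizontal field \<open>Z\<close>, the remaining term of \<open>A\<close> is \<open>- g(\<V>Y, \<nabla>\<^sub>X Z)\<close>, which vanishes at \<open>p\<close>
  because \<open>\<V>Y\<close> does.
\<close>

lemma oneill_A_horizontal:
  assumes y: "y \<in> horizontal M N F p"
  shows "oneill_A_at M N F nabla p x y = vproj M N F p (nabla (hfield M N F p x) (hfield M N F p y) p)"
proof -
  interpret scalar_product "metric M p" by (rule metric_scalar_product[OF dom_riemannian[OF sub]])
  let ?n = "nabla (hfield M N F p x) (vfield M N F p y) p" and ?h = "hproj M N F p"
  have h: "?h ?n \<in> horizontal M N F p" by (rule hproj_in[OF sub])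
  have v0: "vfield M N F p y p = 0"
    by (simp add: vfield_def extend_vec_self[OF dom_smooth[OF sub]] vproj_horizontal[OF sub y])
  have "metric M p ?n (hfield M N F p (?h ?n) p) = 0"
    by (subst nabla_orthogonal)
      (simp_all add: smooth_hfield[OF sub] smooth_vfield[OF sub] horizontal_vertical[OF sub]
        hfield_in[OF sub] vfield_in[OF sub] v0 zero_left)
  then have "metric M p (?h ?n) (?h ?n) = 0"
    by (simp add: hfield_self[OF sub h] hproj_form[OF sub h])
  then show ?thesis by (simp add: oneill_A_at_eq eq_0_iff)
qed

lemma oneill_A_vertical: "y \<in> horizontal M N F p \<Longrightarrow> oneill_A_at M N F nabla p x y \<in> vertical M N F p"
  by (simp add: oneill_A_horizontal vproj_in[OF sub])

text \<open>
  Metric compatibility and vanishing torsion turn \<open>g(A\<^sub>x y + A\<^sub>y x, u)\<close> for vertical \<open>u\<close> into minus the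
  Lie derivative of the metric along a vertical field, evaluated on \<open>x\<close> and \<open>y\<close>. Taking for \<open>u\<close> the sum
  \<open>A\<^sub>x y + A\<^sub>y x\<close> itself shows that it is zero.
\<close>

lemma oneill_A_alternating:
  assumes x: "x \<in> horizontal M N F p" and y: "y \<in> horizontal M N F p"
  shows "oneill_A_at M N F nabla p y x = - oneill_A_at M N F nabla p x y"
proof -
  interpret scalar_product "metric M p" by (rule metric_scalar_product[OF dom_riemannian[OF sub]])
  let ?A = "oneill_A_at M N F nabla p"
  define u where "u = ?A x y + ?A y x"
  let ?X = "hfield M N F p x" and ?Y = "hfield M N F p y" and ?U = "vfield M N F p u"
  have u: "u \<in> vertical M N F p" unfolding u_def
    by (intro subspace_add[OF subspace_vertical[OF sub]] oneill_A_vertical x y)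
  note sX = smooth_hfield[OF sub, of p x] and sY = smooth_hfield[OF sub, of p y] and sU = smooth_vfield[OF sub, of p u]
  note at_p = hfield_self[OF sub x] hfield_self[OF sub y] vfield_self[OF sub u]
  have orth: "metric M q (hfield M N F p z q) (?U q) = 0" for z q
    by (rule horizontal_vertical[OF sub hfield_in[OF sub] vfield_in[OF sub]])
  have A: "metric M p (?A x y) u = - metric M p y (nabla ?X ?U p)" "metric M p (?A y x) u = - metric M p x (nabla ?Y ?U p)"
    using nabla_orthogonal[OF sX sY sU orth] nabla_orthogonal[OF sY sX sU orth]
    by (simp_all add: oneill_A_horizontal x y vproj_form[OF sub u] at_p)
  have XU: "nabla ?X ?U p = nabla ?U ?X p - lie_bracket M ?U ?X p" "nabla ?Y ?U p = nabla ?U ?Y p - lie_bracket M ?U ?Y p"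
    using nabla_torsion_free[OF dom_riemannian[OF sub] LC sU sX] nabla_torsion_free[OF dom_riemannian[OF sub] LC sU sY] by (simp_all add: algebra_simps)
  have "metric M p u u = metric M p (?A x y) u + metric M p (?A y x) u"
    unfolding add_left[symmetric] u_def[symmetric] ..
  also have "\<dots> = metric M p (lie_bracket M ?U ?X p) y + metric M p x (lie_bracket M ?U ?Y p)
      - (metric M p (nabla ?U ?X p) y + metric M p x (nabla ?U ?Y p))"
    unfolding A XU by (simp add: diff_right sym[of y])
  also have "\<dots> = 0"
    using vertical_lie_derivative[OF sub x y u] nabla_metric[OF dom_riemannian[OF sub] LC sU sX sY] by (simp add: at_p)
  finally have "u = 0" by (simp add: eq_0_iff)
  then show ?thesis by (simp add: u_def eq_neg_iff_add_eq_0 add.commute)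
qed

text \<open>
  The defining relation prescribes a linear functional on the horizontal space, which has a unique
  representing vector. Since \<open>A\<^sub>y y = 0\<close> and \<open>A\<^sub>y x = - A\<^sub>x y\<close>, its three terms in \<open>A\<close> add up to a negative
  multiple of a square.
\<close>

lemma horizontal_curvature_form:
  assumes x: "x \<in> horizontal M N F p" and y: "y \<in> horizontal M N F p"
  defines "A \<equiv> oneill_A_at M N F nabla p"
  shows "metric M p (horizontal_curvature M N F nabla p x y y) x =
    metric M p (curvature_at M nabla p x y y) x - 3 * metric M p (A x y) (A x y)"
proof -
  interpret scalar_product "metric M p" by (rule metric_scalar_product[OF dom_riemannian[OF sub]])
  let ?g = "metric M p" and ?H = "horizontal M N F p"
  define \<phi> where "\<phi> w = ?g (curvature_at M nabla p x y y) w + ?g (A x y) (A y w) + ?g (A x y) (A y w) - ?g (A y y) (A x w) + ?g (A x y) (A y w)" for w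
  have linA: "linear (\<lambda>w. ?g a (A z w))" for a z
    using linear_compose[OF linear_oneill_A(1) linear_right] unfolding A_def o_def .
  have "linear \<phi>" unfolding \<phi>_def[abs_def]
    by (intro linear_compose_add linear_compose_sub linear_right linA)
  from riesz_on[OF orthonormal_basis[OF subspace_horizontal[OF sub]] this]
  have ex: "\<exists>!v. v \<in> ?H \<and> (\<forall>w\<in>?H. ?g v w = \<phi> w)" .
  have eq: "?g v w = \<phi> w \<longleftrightarrow> ?g (curvature_at M nabla p x y y) w =
      ?g v w - 2 * ?g (A x y) (A y w) + ?g (A y y) (A x w) - ?g (A x y) (A y w)" for v w
    unfolding \<phi>_def by linarith
  have "?g (horizontal_curvature M N F nabla p x y y) x = \<phi> x"
    using theI'[OF ex] x unfolding eq horizontal_curvature_def Let_def A_def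
    by (simp add: algebra_simps)
  also have "A y y = 0"
    using oneill_A_alternating[OF y y] unfolding A_def by (simp add: eq_neg_iff_add_eq_0 scaleR_2[symmetric])
  then have "\<phi> x = ?g (curvature_at M nabla p x y y) x - 3 * ?g (A x y) (A x y)"
    unfolding \<phi>_def using oneill_A_alternating[OF x y] by (simp add: A_def minus_right zero_left)
  finally show ?thesis .
qed

section \<open>Casorati curvatures\<close>

lemma casorati_nonneg: "casorati M N F nabla p L \<ge> 0"
  unfolding casorati_def Let_def by (intro mult_nonneg_nonneg sum_nonneg) auto

text \<open>
  For each vertical unit vector of the basis, both arguments of the bilinear form \<open>g(A, U\<^sub>k)\<close> can be
  enlarged from \<open>L\<close> to the horizontal space by Bessel's inequality.
\<close>

lemma casorati_hyperplane:
  assumes "L \<in> hyperplanes (horizontal M N F p)" and "dim (horizontal M N F p) \<ge> 2"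
  shows "(real (dim (horizontal M N F p)) - 1) * casorati M N F nabla p L \<le>
    real (dim (horizontal M N F p)) * casorati M N F nabla p (horizontal M N F p)"
proof -
  interpret scalar_product "metric M p" by (rule metric_scalar_product[OF dom_riemannian[OF sub]])
  let ?H = "horizontal M N F p"
  let ?V = "vertical M N F p" and ?A = "oneill_A_at M N F nabla p"
  let ?U = "orthonormal_basis (metric M p) ?V" and ?X = "orthonormal_basis (metric M p)"
  have L: "subspace L" "L \<subseteq> ?H" "dim L = dim ?H - 1" using assms by (auto simp: hyperplanes_def)
  have dL: "real (dim ?H) - 1 = real (dim L)" "dim L \<noteq> 0" "dim ?H \<noteq> 0" using L(3) assms(2) by (simp_all add: of_nat_diff del: dim_eq_0)
  have "(\<Sum>i=1..dim L. \<Sum>j=1..dim L. (metric M p (?A (?X L i) (?X L j)) w)\<^sup>2) \<le>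
      (\<Sum>i=1..dim ?H. \<Sum>j=1..dim ?H. (metric M p (?A (?X ?H i) (?X ?H j)) w)\<^sup>2)" for w
  proof (rule sum_squares_bilinear_onb_mono[OF orthonormal_basis[OF L(1)]
        orthonormal_basis[OF subspace_horizontal[OF sub]] L(2)])
    show "linear (\<lambda>y. metric M p (?A x y) w)" for x
      using linear_compose[OF linear_oneill_A(1) linear_left] unfolding o_def .
    show "linear (\<lambda>x. metric M p (?A x y) w)" for y
      using linear_compose[OF linear_oneill_A(2) linear_left] unfolding o_def .
  qed
  from sum_mono[of "{1..dim ?V}", OF this, of ?U] show ?thesis
    unfolding dL(1) using dL by (simp add: casorati_def Let_def)
qed

lemma delta_C_nonneg: "delta_C M N F nabla p \<ge> 0"
proof -
  interpret scalar_product "metric M p" by (rule metric_scalar_product[OF dom_riemannian[OF sub]])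
  have "0 \<le> (INF L\<in>hyperplanes (horizontal M N F p). casorati M N F nabla p L)"
    by (rule cINF_greatest[OF hyperplanes_nonempty[OF subspace_horizontal[OF sub]] casorati_nonneg])
  then show ?thesis unfolding delta_C_def Let_def
    by (intro add_nonneg_nonneg mult_nonneg_nonneg casorati_nonneg) auto
qed

text \<open>
  The factors balance: \<open>2 - (2s - 1)/(2s) \<cdot> s/(s - 1) = (2s - 3)/(2(s - 1))\<close>, which is positive for
  \<open>s \<ge> 2\<close>.
\<close>

lemma delta_C_hat_nonneg:
  assumes "dim (horizontal M N F p) \<ge> 2"
  shows "delta_C_hat M N F nabla p \<ge> 0"
proof -
  interpret scalar_product "metric M p" by (rule metric_scalar_product[OF dom_riemannian[OF sub]])
  let ?H = "horizontal M N F p"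
  define s where "s = real (dim ?H)"
  have s: "s \<ge> 2" using assms by (simp add: s_def)
  let ?C = "casorati M N F nabla p ?H"
  have "(SUP L\<in>hyperplanes ?H. casorati M N F nabla p L) \<le> s / (s - 1) * ?C"
  proof (rule cSUP_least[OF hyperplanes_nonempty[OF subspace_horizontal[OF sub]]])
    fix L assume "L \<in> hyperplanes ?H"
    from casorati_hyperplane[OF this assms] show "casorati M N F nabla p L \<le> s / (s - 1) * ?C"
      using s by (simp add: s_def[symmetric] field_simps)
  qed
  then have "(2 * s - 1) / (2 * s) * (SUP L\<in>hyperplanes ?H. casorati M N F nabla p L) \<le>
      (2 * s - 1) / (2 * s) * (s / (s - 1) * ?C)"
    using s by (intro mult_left_mono) auto
  also have "\<dots> = (2 * s - 1) / (2 * (s - 1)) * ?C" using s by simp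
  also have "\<dots> \<le> 2 * ?C"
    using s by (intro mult_right_mono casorati_nonneg) (simp add: field_simps)
  finally show ?thesis unfolding delta_C_hat_def Let_def s_def by simp
qed

lemma rho_H_le:
  fixes p :: 'a
  defines "s \<equiv> dim (horizontal M N F p)" and "X \<equiv> orthonormal_basis (metric M p) (horizontal M N F p)"
  assumes s: "s \<ge> 2"
  shows "rho_H M N F nabla p \<le>
    1 / (real s * (real s - 1)) * (\<Sum>i=1..s. \<Sum>j=1..s. metric M p (curvature_at M nabla p (X i) (X j) (X j)) (X i))"
proof -
  interpret scalar_product "metric M p" by (rule metric_scalar_product[OF dom_riemannian[OF sub]])
  have onb: "is_orthonormal_basis (metric M p) (horizontal M N F p) X"
    unfolding X_def by (rule orthonormal_basis[OF subspace_horizontal[OF sub]])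
  have "metric M p (horizontal_curvature M N F nabla p (X i) (X j) (X j)) (X i) \<le>
      metric M p (curvature_at M nabla p (X i) (X j) (X j)) (X i)" if "i \<in> {1..s}" "j \<in> {1..s}" for i j
    using horizontal_curvature_form[of "X i" p "X j"] onb_in[OF onb] that nonneg[of "oneill_A_at M N F nabla p (X i) (X j)"]
    by (simp add: s_def)
  then show ?thesis unfolding rho_H_def Let_def X_def[symmetric] s_def[symmetric]
    using s by (intro mult_left_mono sum_mono) auto
qed

end

section \<open>Pointwise slant submersions from space forms\<close>

text \<open>
  The horizontal part \<open>P\<close> of \<open>J\<close> is skew-symmetric, so \<open>g(Px, Px) = - g(P\<^sup>2x, x)\<close>, and the slant
  condition evaluates \<open>P\<^sup>2\<close>.
\<close>

lemma slant_horizontal_norm: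
  fixes M :: "('a::{t2_space,second_countable_topology}, 'e::euclidean_space, 'm) hermitian_scheme"
    and N :: "('b::{t2_space,second_countable_topology}, 'f::euclidean_space, 'n) riemannian_scheme"
  assumes slant: "pointwise_slant_submersion M N F \<theta>" and x: "x \<in> horizontal M N F p"
    and X: "is_orthonormal_basis (metric M p) (horizontal M N F p) X"
  shows "(\<Sum>i=1..dim (horizontal M N F p). (metric M p (X i) (cplx M p x))\<^sup>2) = (cos (\<theta> p))\<^sup>2 * metric M p x x"
proof -
  have sub: "riemannian_submersion M N F" using slant by (simp add: pointwise_slant_submersion_def)
  interpret scalar_product "metric M p" by (rule metric_scalar_product[OF dom_riemannian[OF sub]])
  let ?H = "horizontal M N F p" and ?J = "cplx M p" and ?g = "metric M p" and ?h = "hproj M N F p"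
  have J: "linear ?J" "\<And>x. ?J (?J x) = - x" "\<And>x y. ?g (?J x) (?J y) = ?g x y"
    using slant by (auto simp: pointwise_slant_submersion_def almost_hermitian_def)
  have skew: "?g (?J a) b = - ?g a (?J b)" for a b
    using J(3)[of a "?J b"] by (simp add: J(2) minus_right)
  have Hx: "?h (?J x) \<in> ?H" by (rule hproj_in[OF sub])
  have "(\<Sum>i=1..dim ?H. (?g (X i) (?J x))\<^sup>2) = (\<Sum>i=1..dim ?H. (?g (?h (?J x)) (X i))\<^sup>2)"
    by (intro sum.cong refl) (use hproj_form[OF sub onb_in[OF X]] sym in auto)
  also have "\<dots> = ?g (?h (?J x)) (?h (?J x))" by (rule parseval[OF X Hx])
  also have "\<dots> = ?g (?J x) (?h (?J x))" by (rule hproj_form[OF sub Hx])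
  also have "\<dots> = - ?g (?J (?h (?J x))) x" by (simp add: skew sym[of x])
  also have "\<dots> = - ?g (?h (?J (?h (?J x)))) x" by (simp add: hproj_form[OF sub x])
  also have "?h (?J (?h (?J x))) = - ((cos (\<theta> p))\<^sup>2 *\<^sub>R x)"
    using slant x by (auto simp: pointwise_slant_submersion_def)
  finally show ?thesis by (simp add: minus_left scale_left)
qed

text \<open>
  As \<open>J\<close> is skew-symmetric, \<open>g(x, Jx) = 0\<close>, and the second bracket of the curvature contributes
  \<open>3 g(x, Jy)\<^sup>2\<close> to the sectional curvature of an orthonormal pair.
\<close>

lemma space_form_curvature_sum:
  fixes M :: "('a::{t2_space,second_countable_topology}, 'e::euclidean_space, 'm) hermitian_scheme"
    and N :: "('b::{t2_space,second_countable_topology}, 'f::euclidean_space, 'n) riemannian_scheme"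
  assumes slant: "pointwise_slant_submersion M N F \<theta>"
    and form: "generalized_complex_space_form M nabla c1 c2"
    and X: "is_orthonormal_basis (metric M p) (horizontal M N F p) X"
  defines "s \<equiv> dim (horizontal M N F p)"
  shows "(\<Sum>i=1..s. \<Sum>j=1..s. metric M p (curvature_at M nabla p (X i) (X j) (X j)) (X i)) =
    real s * (real s - 1) * c1 p + 3 * real s * c2 p * (cos (\<theta> p))\<^sup>2"
proof -
  have sub: "riemannian_submersion M N F" using slant by (simp add: pointwise_slant_submersion_def)
  interpret scalar_product "metric M p" by (rule metric_scalar_product[OF dom_riemannian[OF sub]])
  let ?J = "cplx M p" and ?g = "metric M p"
  have J: "\<And>x. ?J (?J x) = - x" "\<And>x y. ?g (?J x) (?J y) = ?g x y"
    using slant by (auto simp: pointwise_slant_submersion_def almost_hermitian_def)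
  have skew: "?g (?J a) b = - ?g a (?J b)" for a b
    using J(2)[of a "?J b"] by (simp add: J(1) minus_right)
  have skew0: "?g a (?J a) = 0" for a
    using skew[of a a] sym[of a "?J a"] by simp
  note sm = smooth_field_near_extend[OF dom_smooth[OF sub]]
  have R: "curvature_at M nabla p x y y = c1 p *\<^sub>R (?g y y *\<^sub>R x - ?g x y *\<^sub>R y) +
      c2 p *\<^sub>R (?g x (?J y) *\<^sub>R ?J y - ?g y (?J y) *\<^sub>R ?J x + (2 * ?g x (?J y)) *\<^sub>R ?J y)" for x y
    using form sm[of p] unfolding generalized_complex_space_form_def curvature_at_def Let_def
    by (simp add: extend_vec_self[OF dom_smooth[OF sub]])
  have gR: "?g (curvature_at M nabla p x y y) x = c1 p * (?g x x * ?g y y - (?g x y)\<^sup>2) + 3 * c2 p * (?g x (?J y))\<^sup>2" for x y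
    unfolding R by (simp add: form_simps skew0 sym[of "?J y" x] sym[of y x] power2_eq_square algebra_simps)
  have "(\<Sum>i=1..s. \<Sum>j=1..s. ?g (curvature_at M nabla p (X i) (X j) (X j)) (X i)) =
      (\<Sum>i=1..s. \<Sum>j=1..s. c1 p * (1 - (if i = j then 1 else 0)) + 3 * c2 p * (?g (X i) (?J (X j)))\<^sup>2)"
    by (intro sum.cong refl) (auto simp: gR onb_orthonormal[OF X] s_def)
  also have "\<dots> = c1 p * (\<Sum>i=1..s. \<Sum>j=1..s. 1 - (if i = j then 1 else 0)) +
      3 * c2 p * (\<Sum>i=1..s. \<Sum>j=1..s. (?g (X i) (?J (X j)))\<^sup>2)"
    by (simp add: sum.distrib sum_distrib_left)
  also have "(\<Sum>i=1..s. \<Sum>j=1..s. 1 - (if i = j then 1 else 0)) = real s * (real s - 1)"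
    by (simp add: sum_subtractf algebra_simps)
  also have "(\<Sum>i=1..s. \<Sum>j=1..s. (?g (X i) (?J (X j)))\<^sup>2) = (\<Sum>j=1..s. \<Sum>i=1..s. (?g (X i) (?J (X j)))\<^sup>2)"
    by (rule sum.swap)
  also have "\<dots> = (\<Sum>j=1..s. (cos (\<theta> p))\<^sup>2)"
    unfolding s_def using slant_horizontal_norm[OF slant onb_in[OF X] X] onb_orthonormal[OF X]
    by (intro sum.cong refl) auto
  finally show ?thesis by (simp add: algebra_simps)
qed

lemma rho_H_le_delta_C:
  fixes M :: "('a::{t2_space,second_countable_topology}, 'e::euclidean_space, 'm) hermitian_scheme"
    and N :: "('b::{t2_space,second_countable_topology}, 'f::euclidean_space, 'n) riemannian_scheme"
  assumes LC: "levi_civita M nabla" and slant: "pointwise_slant_submersion M N F \<theta>"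
    and form: "generalized_complex_space_form M nabla c1 c2"
    and s: "dim (horizontal M N F p) = s" "s \<ge> 2"
  shows "rho_H M N F nabla p \<le> delta_C M N F nabla p + c1 p + 3 * c2 p / (real s - 1) * (cos (\<theta> p))\<^sup>2"
    and "rho_H M N F nabla p \<le> delta_C_hat M N F nabla p + c1 p + 3 * c2 p / (real s - 1) * (cos (\<theta> p))\<^sup>2"
proof -
  have sub: "riemannian_submersion M N F" using slant by (simp add: pointwise_slant_submersion_def)
  interpret scalar_product "metric M p" by (rule metric_scalar_product[OF dom_riemannian[OF sub]])
  have "rho_H M N F nabla p \<le> 1 / (real s * (real s - 1)) *
      (real s * (real s - 1) * c1 p + 3 * real s * c2 p * (cos (\<theta> p))\<^sup>2)"
    using rho_H_le[OF sub LC, of p] s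
      space_form_curvature_sum[OF slant form orthonormal_basis[OF subspace_horizontal[OF sub]]] by simp
  also have "\<dots> = c1 p + 3 * c2 p / (real s - 1) * (cos (\<theta> p))\<^sup>2"
    using s by (simp add: field_simps)
  finally have le: "rho_H M N F nabla p \<le> c1 p + 3 * c2 p / (real s - 1) * (cos (\<theta> p))\<^sup>2" .
  show "rho_H M N F nabla p \<le> delta_C M N F nabla p + c1 p + 3 * c2 p / (real s - 1) * (cos (\<theta> p))\<^sup>2"
    using le delta_C_nonneg[OF sub LC, of p] by simp
  show "rho_H M N F nabla p \<le> delta_C_hat M N F nabla p + c1 p + 3 * c2 p / (real s - 1) * (cos (\<theta> p))\<^sup>2"
    using le delta_C_hat_nonneg[OF sub LC, of p] s by simp
qed

theorem corollary5p1:
  fixes M1 :: "('a::{t2_space,second_countable_topology}, 'e::euclidean_space) hermitian"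
    and M2 :: "('b::{t2_space,second_countable_topology}, 'f::euclidean_space) riemannian"
    and F :: "'a \<Rightarrow> 'b" and \<theta> :: "'a \<Rightarrow> real"
    and nabla :: "('a \<Rightarrow> 'e) \<Rightarrow> ('a \<Rightarrow> 'e) \<Rightarrow> 'a \<Rightarrow> 'e"
    and s :: nat and c \<alpha> :: real and p :: 'a
  assumes "levi_civita M1 nabla"
    and "pointwise_slant_submersion M1 M2 F \<theta>"
    and "\<forall>q. dim (horizontal M1 M2 F q) = s" and "s \<ge> 3"
  shows
    "(real_space_form M1 nabla c \<longrightarrow>
        rho_H M1 M2 F nabla p \<le> delta_C M1 M2 F nabla p + c \<and>
        rho_H M1 M2 F nabla p \<le> delta_C_hat M1 M2 F nabla p + c) \<and>
     (complex_space_form M1 nabla c \<longrightarrow>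
        rho_H M1 M2 F nabla p \<le> delta_C M1 M2 F nabla p
          + c / 4 * (1 + 3 / (real s - 1) * (cos (\<theta> p))\<^sup>2) \<and>
        rho_H M1 M2 F nabla p \<le> delta_C_hat M1 M2 F nabla p
          + c / 4 * (1 + 3 / (real s - 1) * (cos (\<theta> p))\<^sup>2)) \<and>
     (real_kaehler_space_form M1 nabla c \<alpha> \<longrightarrow>
        rho_H M1 M2 F nabla p \<le> delta_C M1 M2 F nabla p
          + (c + 3 * \<alpha>) / 4 + 3 * (c - \<alpha>) / (4 * (real s - 1)) * (cos (\<theta> p))\<^sup>2 \<and>
        rho_H M1 M2 F nabla p \<le> delta_C_hat M1 M2 F nabla p
          + (c + 3 * \<alpha>) / 4 + 3 * (c - \<alpha>) / (4 * (real s - 1)) * (cos (\<theta> p))\<^sup>2)"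
proof -
  have s: "dim (horizontal M1 M2 F p) = s" "s \<ge> 2" using assms(3,4) by auto
  note le = rho_H_le_delta_C[OF assms(1,2) _ s]
  have "3 * ((c - \<alpha>) / 4) / (real s - 1) = 3 * (c - \<alpha>) / (4 * (real s - 1))" by simp
  then show ?thesis
    using le[of "\<lambda>_. c" "\<lambda>_. 0"] le[of "\<lambda>_. c / 4" "\<lambda>_. c / 4"]
      le[of "\<lambda>_. (c + 3 * \<alpha>) / 4" "\<lambda>_. (c - \<alpha>) / 4"]
    unfolding real_space_form_def complex_space_form_def real_kaehler_space_form_def
    by (simp add: algebra_simps)
qed

end
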